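(* For every category $\mathbf{C}$, the tape category $\mathcal{T}(\mathbf{C})$ is a convex biproduct category, with the PCA-enrichment $f+_pg:=\Delta^p_P;(f\oplus g);\nabla_Q$ and $\star_{P,Q}:=\,!_P;¡_Q$, zero object the empty word $0$, and binary $\oplus$ given by concatenation with injections $\mathrm{id}_{P_1}\oplus¡_{P_2}$, $¡_{P_1}\oplus\mathrm{id}_{P_2}$ and projections $\mathrm{id}_{P_1}\oplus!_{P_2}$, $!_{P_1}\oplus\mathrm{id}_{P_2}$. Moreover, for all objects $U,U_1,\dots,U_n$ of $\mathbf{C}$, all $\vec p=p_1,\dots,p_n\in[0,1]$ with $\sum_ip_i\le1$ and all $t_i\colon U\to U_i$, the $n$-ary convex pairing satisfies $\langle t_1,\dots,t_n\rangle_{\vec p}=\Delta^{\vec p}_{U,n};\bigoplus_{i=1}^nt_i$ (the unique arrow whose composite with the $i$-th projection $!\oplus\mathrm{id}_{U_i}\oplus!$ is $p_i\cdot t_i$).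
   Context: Composition is diagrammatic. A pca is a set with $\star$ and $+_p$ ($p\in(0,1)$) satisfying $(x_1+_q x_2)+_p x_3=x_1+_{pq}(x_2+_{\tilde q}x_3)$ ($\tilde q=\frac{p(1-q)}{1-pq}$), $x_1+_px_2=x_2+_{1-p}x_1$, $x+_px=x$; $x+_1y=x$, $x+_0y=y$, $p\cdot x:=x+_p\star$. A convex biproduct category is a category whose hom-sets are pcas with composition preserving $+_p,\star$ in each argument, having an object $0$ both initial and terminal and, for all $X_1,X_2$, an object $X_1\oplus X_2$ with $\iota_i,\pi_i$ making it a coproduct (via $\iota_i$) and a convex product (via $\pi_i$: for all $p_1+p_2\le1$ in $[0,1]$ and $f_i\colon A\to X_i$ a unique $h$ with $h;\pi_i=p_i\cdot f_i$), with $\iota_i;\pi_j=\mathrm{id}$ if $i=j$, $\star$ otherwise. The tape category $\mathcal{T}(\mathbf{C})$: objects are finite words over $\mathrm{Ob}(\mathbf{C})$ (written $\bigoplus_kU_k$, empty word $0$); arrows are terms built from generators $\Delta^p_U\colon U\to U\oplus U$ ($p\in(0,1)$), $!_U\colon U\to0$, $\nabla_U\colon U\oplus U\to U$, $¡_U\colon0\to U$, $\sigma_{U,V}$, $\mathrm{id}_U$, $\mathrm{id}_0$, and $\underline c\colon U\to V$ for $c\in\mathbf{C}[U,V]$, under $;$ and $\oplus$, modulo: strict symmetric monoidal category axioms; $\underline{\mathrm{id}_U}=\mathrm{id}_U$, $\underline{c;d}=\underline c;\underline d$; commutative monoid laws for $(\nabla,¡)$ with naturality $¡_P;f=¡_Q$,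 $\nabla_P;f=(f\oplus f);\nabla_Q$; co-pca laws $\Delta^p_P;(\Delta^q_P\oplus\mathrm{id}_P)=\Delta^{pq}_P;(\mathrm{id}_P\oplus\Delta^{\tilde q}_P)$, $\Delta^p_P;\nabla_P=\mathrm{id}_P$, $\Delta^p_P;\sigma_{P,P}=\Delta^{1-p}_P$, with naturality $f;!_Q=\,!_P$, $f;\Delta^p_Q=\Delta^p_P;(f\oplus f)$; structure on words defined inductively ($\Delta^p_0=!_0=\nabla_0=¡_0=\mathrm{id}_0$, $!_{UP}=!_U\oplus!_P$, $¡_{UP}=¡_U\oplus¡_P$, $\Delta^p_{UP}=(\Delta^p_U\oplus\Delta^p_P);(\mathrm{id}_U\oplus\sigma_{U,P}\oplus\mathrm{id}_P)$, $\nabla_{UP}=(\mathrm{id}_U\oplus\sigma_{P,U}\oplus\mathrm{id}_P);(\nabla_U\oplus\nabla_P)$). Extended splittings: $\Delta^0_U:=¡_U\oplus\mathrm{id}_U$, $\Delta^1_U:=\mathrm{id}_U\oplus¡_U$; $\Delta^{\vec p}_{U,0}:=!_U$, $\Delta^{\vec p}_{U,n+1}:=\Delta^{p_1}_U;(\mathrm{id}_U\oplus\Delta^{\vec q}_{U,n})$ with $q_i=\frac{p_{i+1}}{1-p_1}$ if $p_1\ne1$, else $0$. *)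

theory Defs
  imports Complex_Main
begin

text \<open>Composition is in diagrammatic order throughout.\<close>

record ('o, 'a) category =
  Ob :: "'o set"
  Ar :: "'a set"
  Dom :: "'a \<Rightarrow> 'o"
  Cod :: "'a \<Rightarrow> 'o"
  Ident :: "'o \<Rightarrow> 'a"
  Cmp :: "'a \<Rightarrow> 'a \<Rightarrow> 'a"  (infixl "\<odot>\<index>" 65)

definition hom :: "('o, 'a, 'm) category_scheme \<Rightarrow> 'o \<Rightarrow> 'o \<Rightarrow> 'a set" where
  "hom C A B = {f \<in> Ar C. Dom C f = A \<and> Cod C f = B}"

locale category =
  fixes C :: "('o, 'a, 'm) category_scheme" (structure)
  assumes dom_ob: "f \<in> Ar C \<Longrightarrow> Dom C f \<in> Ob C"
    and cod_ob: "f \<in> Ar C \<Longrightarrow> Cod C f \<in> Ob C"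
    and ident_hom: "A \<in> Ob C \<Longrightarrow> Ident C A \<in> hom C A A"
    and cmp_hom: "f \<in> hom C A B \<Longrightarrow> g \<in> hom C B D \<Longrightarrow> f \<odot> g \<in> hom C A D"
    and ident_left: "f \<in> hom C A B \<Longrightarrow> Ident C A \<odot> f = f"
    and ident_right: "f \<in> hom C A B \<Longrightarrow> f \<odot> Ident C B = f"
    and cmp_assoc: "f \<in> hom C A B \<Longrightarrow> g \<in> hom C B D \<Longrightarrow> h \<in> hom C D E \<Longrightarrow>
        (f \<odot> g) \<odot> h = f \<odot> (g \<odot> h)"

locale pca =
  fixes S :: "'a set" and star :: 'a and cvx :: "real \<Rightarrow> 'a \<Rightarrow> 'a \<Rightarrow> 'a"
  assumes star_closed: "star \<in> S"
    and plus_closed: "0 < p \<Longrightarrow> p < 1 \<Longrightarrow> x \<in> S \<Longrightarrow> y \<in> S \<Longrightarrow> cvx p x y \<in> S"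
    and plus_assoc: "0 < p \<Longrightarrow> p < 1 \<Longrightarrow> 0 < q \<Longrightarrow> q < 1 \<Longrightarrow> x \<in> S \<Longrightarrow> y \<in> S \<Longrightarrow> z \<in> S \<Longrightarrow>
        cvx p (cvx q x y) z = cvx (p * q) x (cvx (p * (1 - q) / (1 - p * q)) y z)"
    and plus_comm: "0 < p \<Longrightarrow> p < 1 \<Longrightarrow> x \<in> S \<Longrightarrow> y \<in> S \<Longrightarrow> cvx p x y = cvx (1 - p) y x"
    and plus_idem: "0 < p \<Longrightarrow> p < 1 \<Longrightarrow> x \<in> S \<Longrightarrow> cvx p x x = x"

definition ext_plus :: "(real \<Rightarrow> 'a \<Rightarrow> 'a \<Rightarrow> 'a) \<Rightarrow> real \<Rightarrow> 'a \<Rightarrow> 'a \<Rightarrow> 'a" where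
  "ext_plus cvx p x y = (if p = 1 then x else if p = 0 then y else cvx p x y)"

text \<open>On arrows, \<open>cvx\<close> does not mention the hom-set, which is determined by its arguments.\<close>

locale pca_enriched_category = category C
  for C :: "('o, 'a, 'm) category_scheme" (structure) +
  fixes star :: "'o \<Rightarrow> 'o \<Rightarrow> 'a" and cvx :: "real \<Rightarrow> 'a \<Rightarrow> 'a \<Rightarrow> 'a"
  assumes hom_pca: "A \<in> Ob C \<Longrightarrow> B \<in> Ob C \<Longrightarrow> pca (hom C A B) (star A B) cvx"
    and cmp_plus_right: "0 < p \<Longrightarrow> p < 1 \<Longrightarrow> f \<in> hom C A B \<Longrightarrow> g \<in> hom C B D \<Longrightarrow> h \<in> hom C B D \<Longrightarrow>
        f \<odot> cvx p g h = cvx p (f \<odot> g) (f \<odot> h)"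
    and cmp_plus_left: "0 < p \<Longrightarrow> p < 1 \<Longrightarrow> f \<in> hom C A B \<Longrightarrow> g \<in> hom C A B \<Longrightarrow> h \<in> hom C B D \<Longrightarrow>
        cvx p f g \<odot> h = cvx p (f \<odot> h) (g \<odot> h)"
    and cmp_star_right: "f \<in> hom C A B \<Longrightarrow> D \<in> Ob C \<Longrightarrow> f \<odot> star B D = star A D"
    and cmp_star_left: "A \<in> Ob C \<Longrightarrow> f \<in> hom C B D \<Longrightarrow> star A B \<odot> f = star A D"

definition scal :: "('o, 'a, 'm) category_scheme \<Rightarrow> ('o \<Rightarrow> 'o \<Rightarrow> 'a) \<Rightarrow> (real \<Rightarrow> 'a \<Rightarrow> 'a \<Rightarrow> 'a) \<Rightarrow>
    real \<Rightarrow> 'a \<Rightarrow> 'a" where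
  "scal C star cvx p f = ext_plus cvx p f (star (Dom C f) (Cod C f))"

definition is_zero_object :: "('o, 'a, 'm) category_scheme \<Rightarrow> 'o \<Rightarrow> bool" where
  "is_zero_object C Z \<longleftrightarrow> Z \<in> Ob C \<and>
     (\<forall>A\<in>Ob C. (\<exists>!f. f \<in> hom C Z A) \<and> (\<exists>!f. f \<in> hom C A Z))"

definition is_coproduct :: "('o, 'a, 'm) category_scheme \<Rightarrow> 'o \<Rightarrow> 'o \<Rightarrow> 'o \<Rightarrow> 'a \<Rightarrow> 'a \<Rightarrow> bool" where
  "is_coproduct C X1 X2 B i1 i2 \<longleftrightarrow>
     B \<in> Ob C \<and> i1 \<in> hom C X1 B \<and> i2 \<in> hom C X2 B \<and>
     (\<forall>A\<in>Ob C. \<forall>f1\<in>hom C X1 A. \<forall>f2\<in>hom C X2 A.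
        \<exists>!h. h \<in> hom C B A \<and> i1 \<odot>\<^bsub>C\<^esub> h = f1 \<and> i2 \<odot>\<^bsub>C\<^esub> h = f2)"

definition is_convex_product :: "('o, 'a, 'm) category_scheme \<Rightarrow> ('o \<Rightarrow> 'o \<Rightarrow> 'a) \<Rightarrow>
    (real \<Rightarrow> 'a \<Rightarrow> 'a \<Rightarrow> 'a) \<Rightarrow> 'o \<Rightarrow> 'o \<Rightarrow> 'o \<Rightarrow> 'a \<Rightarrow> 'a \<Rightarrow> bool" where
  "is_convex_product C star cvx X1 X2 B \<pi>1 \<pi>2 \<longleftrightarrow>
     B \<in> Ob C \<and> \<pi>1 \<in> hom C B X1 \<and> \<pi>2 \<in> hom C B X2 \<and>
     (\<forall>A\<in>Ob C. \<forall>p1\<in>{0..1}. \<forall>p2\<in>{0..1}. p1 + p2 \<le> 1 \<longrightarrow>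
       (\<forall>f1\<in>hom C A X1. \<forall>f2\<in>hom C A X2.
          \<exists>!h. h \<in> hom C A B \<and>
            h \<odot>\<^bsub>C\<^esub> \<pi>1 = scal C star cvx p1 f1 \<and> h \<odot>\<^bsub>C\<^esub> \<pi>2 = scal C star cvx p2 f2))"

definition is_convex_biproduct :: "('o, 'a, 'm) category_scheme \<Rightarrow> ('o \<Rightarrow> 'o \<Rightarrow> 'a) \<Rightarrow>
    (real \<Rightarrow> 'a \<Rightarrow> 'a \<Rightarrow> 'a) \<Rightarrow> 'o \<Rightarrow> 'o \<Rightarrow> 'o \<Rightarrow> 'a \<Rightarrow> 'a \<Rightarrow> 'a \<Rightarrow> 'a \<Rightarrow> bool" where
  "is_convex_biproduct C star cvx X1 X2 B i1 i2 \<pi>1 \<pi>2 \<longleftrightarrow>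
     is_coproduct C X1 X2 B i1 i2 \<and> is_convex_product C star cvx X1 X2 B \<pi>1 \<pi>2 \<and>
     i1 \<odot>\<^bsub>C\<^esub> \<pi>1 = Ident C X1 \<and> i2 \<odot>\<^bsub>C\<^esub> \<pi>2 = Ident C X2 \<and>
     i1 \<odot>\<^bsub>C\<^esub> \<pi>2 = star X1 X2 \<and> i2 \<odot>\<^bsub>C\<^esub> \<pi>1 = star X2 X1"

locale convex_biproduct_category = pca_enriched_category C star cvx
  for C :: "('o, 'a, 'm) category_scheme" (structure)
    and star :: "'o \<Rightarrow> 'o \<Rightarrow> 'a" and cvx :: "real \<Rightarrow> 'a \<Rightarrow> 'a \<Rightarrow> 'a" +
  assumes ex_zero: "\<exists>Z. is_zero_object C Z"
    and ex_biproduct: "X1 \<in> Ob C \<Longrightarrow> X2 \<in> Ob C \<Longrightarrow>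
        \<exists>B i1 i2 \<pi>1 \<pi>2. is_convex_biproduct C star cvx X1 X2 B i1 i2 \<pi>1 \<pi>2"

text \<open>
  An \<open>n\<close>-ary convex pairing of arrows \<open>fs\<close> out of \<open>A\<close> with weights \<open>ps\<close>, relative to an object
  \<open>B\<close> with projections \<open>\<pi>s\<close>.
\<close>

definition is_convex_pairing :: "('o, 'a, 'm) category_scheme \<Rightarrow> ('o \<Rightarrow> 'o \<Rightarrow> 'a) \<Rightarrow>
    (real \<Rightarrow> 'a \<Rightarrow> 'a \<Rightarrow> 'a) \<Rightarrow> 'o \<Rightarrow> 'o \<Rightarrow> 'a list \<Rightarrow> real list \<Rightarrow> 'a list \<Rightarrow> 'a \<Rightarrow> bool" where
  "is_convex_pairing C star cvx A B \<pi>s ps fs h \<longleftrightarrow>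
     h \<in> hom C A B \<and>
     (\<forall>i<length \<pi>s. h \<odot>\<^bsub>C\<^esub> (\<pi>s ! i) = scal C star cvx (ps ! i) (fs ! i))"

definition convex_pairing :: "('o, 'a, 'm) category_scheme \<Rightarrow> ('o \<Rightarrow> 'o \<Rightarrow> 'a) \<Rightarrow>
    (real \<Rightarrow> 'a \<Rightarrow> 'a \<Rightarrow> 'a) \<Rightarrow> 'o \<Rightarrow> 'o \<Rightarrow> 'a list \<Rightarrow> real list \<Rightarrow> 'a list \<Rightarrow> 'a" where
  "convex_pairing C star cvx A B \<pi>s ps fs = (THE h. is_convex_pairing C star cvx A B \<pi>s ps fs h)"

text \<open>
  \<open>Gen c\<close> carries no objects: its type is read off from \<open>Dom\<close> and \<open>Cod\<close> of the base category.
\<close>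

datatype ('o, 'a) tape =
    Split real 'o
  | Bang 'o
  | Merge 'o
  | Cobang 'o
  | Swap 'o 'o
  | IdO 'o
  | IdZ
  | Gen 'a
  | Seq "('o, 'a) tape" "('o, 'a) tape"  (infixl ";;" 65)
  | Par "('o, 'a) tape" "('o, 'a) tape"  (infixr "\<oplus>" 70)

primrec src :: "('o, 'a, 'm) category_scheme \<Rightarrow> ('o, 'a) tape \<Rightarrow> 'o list" where
  "src C (Split p U) = [U]"
| "src C (Bang U) = [U]"
| "src C (Merge U) = [U, U]"
| "src C (Cobang U) = []"
| "src C (Swap U V) = [U, V]"
| "src C (IdO U) = [U]"
| "src C IdZ = []"
| "src C (Gen c) = [Dom C c]"
| "src C (s ;; t) = src C s"
| "src C (s \<oplus> t) = src C s @ src C t"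

primrec tgt :: "('o, 'a, 'm) category_scheme \<Rightarrow> ('o, 'a) tape \<Rightarrow> 'o list" where
  "tgt C (Split p U) = [U, U]"
| "tgt C (Bang U) = []"
| "tgt C (Merge U) = [U]"
| "tgt C (Cobang U) = [U]"
| "tgt C (Swap U V) = [V, U]"
| "tgt C (IdO U) = [U]"
| "tgt C IdZ = []"
| "tgt C (Gen c) = [Cod C c]"
| "tgt C (s ;; t) = tgt C t"
| "tgt C (s \<oplus> t) = tgt C s @ tgt C t"

primrec typed :: "('o, 'a, 'm) category_scheme \<Rightarrow> ('o, 'a) tape \<Rightarrow> bool" where
  "typed C (Split p U) \<longleftrightarrow> 0 < p \<and> p < 1 \<and> U \<in> Ob C"
| "typed C (Bang U) \<longleftrightarrow> U \<in> Ob C"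
| "typed C (Merge U) \<longleftrightarrow> U \<in> Ob C"
| "typed C (Cobang U) \<longleftrightarrow> U \<in> Ob C"
| "typed C (Swap U V) \<longleftrightarrow> U \<in> Ob C \<and> V \<in> Ob C"
| "typed C (IdO U) \<longleftrightarrow> U \<in> Ob C"
| "typed C IdZ \<longleftrightarrow> True"
| "typed C (Gen c) \<longleftrightarrow> c \<in> Ar C"
| "typed C (s ;; t) \<longleftrightarrow> typed C s \<and> typed C t \<and> tgt C s = src C t"
| "typed C (s \<oplus> t) \<longleftrightarrow> typed C s \<and> typed C t"

definition tm :: "('o, 'a, 'm) category_scheme \<Rightarrow> 'o list \<Rightarrow> 'o list \<Rightarrow> ('o, 'a) tape set" where
  "tm C P Q = {t. typed C t \<and> src C t = P \<and> tgt C t = Q}"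

primrec idw :: "'o list \<Rightarrow> ('o, 'a) tape" where
  "idw [] = IdZ"
| "idw (U # P) = IdO U \<oplus> idw P"

primrec swap1 :: "'o \<Rightarrow> 'o list \<Rightarrow> ('o, 'a) tape" where
  "swap1 U [] = IdO U"
| "swap1 U (V # Q) = (Swap U V \<oplus> idw Q) ;; (IdO V \<oplus> swap1 U Q)"

primrec swapw :: "'o list \<Rightarrow> 'o list \<Rightarrow> ('o, 'a) tape" where
  "swapw [] Q = idw Q"
| "swapw (U # P) Q = (IdO U \<oplus> swapw P Q) ;; (swap1 U Q \<oplus> idw P)"

primrec bangw :: "'o list \<Rightarrow> ('o, 'a) tape" where
  "bangw [] = IdZ"
| "bangw (U # P) = Bang U \<oplus> bangw P"

primrec cobangw :: "'o list \<Rightarrow> ('o, 'a) tape" where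
  "cobangw [] = IdZ"
| "cobangw (U # P) = Cobang U \<oplus> cobangw P"

primrec splitw :: "real \<Rightarrow> 'o list \<Rightarrow> ('o, 'a) tape" where
  "splitw p [] = IdZ"
| "splitw p (U # P) = (Split p U \<oplus> splitw p P) ;; (IdO U \<oplus> swapw [U] P \<oplus> idw P)"

primrec mergew :: "'o list \<Rightarrow> ('o, 'a) tape" where
  "mergew [] = IdZ"
| "mergew (U # P) = (IdO U \<oplus> swapw P [U] \<oplus> idw P) ;; (Merge U \<oplus> mergew P)"

definition ext_split :: "real \<Rightarrow> 'o \<Rightarrow> ('o, 'a) tape" where
  "ext_split p U =
     (if p = 0 then Cobang U \<oplus> IdO U else if p = 1 then IdO U \<oplus> Cobang U else Split p U)"

fun multi_split :: "real list \<Rightarrow> 'o \<Rightarrow> ('o, 'a) tape" where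
  "multi_split [] U = Bang U"
| "multi_split (p # ps) U =
     ext_split p U ;; (IdO U \<oplus> multi_split (map (\<lambda>r. if p \<noteq> 1 then r / (1 - p) else 0) ps) U)"

text \<open>
  Only well-typed terms are related, and related terms have the same source and target. The laws
  are imposed on words; those that already follow from the recursive definitions of the structural
  terms and the remaining laws are kept so that the presentation is visibly complete.
\<close>

inductive teq :: "('o, 'a, 'm) category_scheme \<Rightarrow> ('o, 'a) tape \<Rightarrow> ('o, 'a) tape \<Rightarrow> bool"
  for C :: "('o, 'a, 'm) category_scheme" where
  refl: "typed C t \<Longrightarrow> teq C t t"
| sym: "teq C s t \<Longrightarrow> teq C t s"
| trans: "teq C s t \<Longrightarrow> teq C t u \<Longrightarrow> teq C s u"
| seq_cong: "teq C s s' \<Longrightarrow> teq C t t' \<Longrightarrow> tgt C s = src C t \<Longrightarrow> teq C (s ;; t) (s' ;; t')"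
| par_cong: "teq C s s' \<Longrightarrow> teq C t t' \<Longrightarrow> teq C (s \<oplus> t) (s' \<oplus> t')"
| seq_assoc: "f \<in> tm C P Q \<Longrightarrow> g \<in> tm C Q R \<Longrightarrow> h \<in> tm C R S \<Longrightarrow>
    teq C ((f ;; g) ;; h) (f ;; (g ;; h))"
| seq_id_left: "f \<in> tm C P Q \<Longrightarrow> teq C (idw P ;; f) f"
| seq_id_right: "f \<in> tm C P Q \<Longrightarrow> teq C (f ;; idw Q) f"
| par_assoc: "typed C f \<Longrightarrow> typed C g \<Longrightarrow> typed C h \<Longrightarrow> teq C ((f \<oplus> g) \<oplus> h) (f \<oplus> (g \<oplus> h))"
| par_unit_left: "typed C f \<Longrightarrow> teq C (IdZ \<oplus> f) f"
| par_unit_right: "typed C f \<Longrightarrow> teq C (f \<oplus> IdZ) f"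
| par_id: "P \<in> lists (Ob C) \<Longrightarrow> Q \<in> lists (Ob C) \<Longrightarrow> teq C (idw P \<oplus> idw Q) (idw (P @ Q))"
| interchange: "f \<in> tm C P Q \<Longrightarrow> g \<in> tm C Q R \<Longrightarrow> f' \<in> tm C P' Q' \<Longrightarrow> g' \<in> tm C Q' R' \<Longrightarrow>
    teq C ((f \<oplus> f') ;; (g \<oplus> g')) ((f ;; g) \<oplus> (f' ;; g'))"
| swap_swap: "P \<in> lists (Ob C) \<Longrightarrow> Q \<in> lists (Ob C) \<Longrightarrow>
    teq C (swapw P Q ;; swapw Q P) (idw (P @ Q))"
| swap_nat: "f \<in> tm C P Q \<Longrightarrow> g \<in> tm C P' Q' \<Longrightarrow>
    teq C ((f \<oplus> g) ;; swapw Q Q') (swapw P P' ;; (g \<oplus> f))"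
| swap_unit: "P \<in> lists (Ob C) \<Longrightarrow> teq C (swapw P []) (idw P)"
| swap_hexagon: "P \<in> lists (Ob C) \<Longrightarrow> Q \<in> lists (Ob C) \<Longrightarrow> R \<in> lists (Ob C) \<Longrightarrow>
    teq C (swapw (P @ Q) R) ((idw P \<oplus> swapw Q R) ;; (swapw P R \<oplus> idw Q))"
| gen_id: "U \<in> Ob C \<Longrightarrow> teq C (Gen (Ident C U)) (IdO U)"
| gen_cmp: "c \<in> hom C U V \<Longrightarrow> d \<in> hom C V W \<Longrightarrow> teq C (Gen (c \<odot>\<^bsub>C\<^esub> d)) (Gen c ;; Gen d)"
| merge_assoc: "P \<in> lists (Ob C) \<Longrightarrow>
    teq C ((mergew P \<oplus> idw P) ;; mergew P) ((idw P \<oplus> mergew P) ;; mergew P)"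
| merge_unit: "P \<in> lists (Ob C) \<Longrightarrow> teq C ((cobangw P \<oplus> idw P) ;; mergew P) (idw P)"
| merge_comm: "P \<in> lists (Ob C) \<Longrightarrow> teq C (swapw P P ;; mergew P) (mergew P)"
| cobang_nat: "f \<in> tm C P Q \<Longrightarrow> teq C (cobangw P ;; f) (cobangw Q)"
| merge_nat: "f \<in> tm C P Q \<Longrightarrow> teq C (mergew P ;; f) ((f \<oplus> f) ;; mergew Q)"
| split_assoc: "0 < p \<Longrightarrow> p < 1 \<Longrightarrow> 0 < q \<Longrightarrow> q < 1 \<Longrightarrow> P \<in> lists (Ob C) \<Longrightarrow>
    teq C (splitw p P ;; (splitw q P \<oplus> idw P))
          (splitw (p * q) P ;; (idw P \<oplus> splitw (p * (1 - q) / (1 - p * q)) P))"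
| split_merge: "0 < p \<Longrightarrow> p < 1 \<Longrightarrow> P \<in> lists (Ob C) \<Longrightarrow> teq C (splitw p P ;; mergew P) (idw P)"
| split_comm: "0 < p \<Longrightarrow> p < 1 \<Longrightarrow> P \<in> lists (Ob C) \<Longrightarrow>
    teq C (splitw p P ;; swapw P P) (splitw (1 - p) P)"
| bang_nat: "f \<in> tm C P Q \<Longrightarrow> teq C (f ;; bangw Q) (bangw P)"
| split_nat: "0 < p \<Longrightarrow> p < 1 \<Longrightarrow> f \<in> tm C P Q \<Longrightarrow>
    teq C (f ;; splitw p Q) (splitw p P ;; (f \<oplus> f))"

definition cls :: "('o, 'a, 'm) category_scheme \<Rightarrow> ('o, 'a) tape \<Rightarrow> ('o, 'a) tape set" where
  "cls C t = {s. teq C t s}"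

text \<open>
  Operations on classes act on chosen representatives, which is legitimate because \<open>teq\<close> is a
  congruence preserving sources and targets.
\<close>

definition rep :: "('o, 'a) tape set \<Rightarrow> ('o, 'a) tape" where
  "rep X = (SOME t. t \<in> X)"

definition tape_category ::
    "('o, 'a, 'm) category_scheme \<Rightarrow> ('o list, ('o, 'a) tape set) category" where
  "tape_category C =
     \<lparr> Ob = lists (Ob C),
       Ar = cls C ` {t. typed C t},
       Dom = (\<lambda>X. src C (rep X)),
       Cod = (\<lambda>X. tgt C (rep X)),
       Ident = (\<lambda>P. cls C (idw P)),
       Cmp = (\<lambda>X Y. cls C (rep X ;; rep Y)) \<rparr>"

definition tape_par :: "('o, 'a, 'm) category_scheme \<Rightarrow>
    ('o, 'a) tape set \<Rightarrow> ('o, 'a) tape set \<Rightarrow> ('o, 'a) tape set" where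
  "tape_par C X Y = cls C (rep X \<oplus> rep Y)"

definition tape_big_par :: "('o, 'a, 'm) category_scheme \<Rightarrow>
    ('o, 'a) tape set list \<Rightarrow> ('o, 'a) tape set" where
  "tape_big_par C Xs = foldr (tape_par C) Xs (cls C IdZ)"

definition tape_star :: "('o, 'a, 'm) category_scheme \<Rightarrow> 'o list \<Rightarrow> 'o list \<Rightarrow> ('o, 'a) tape set" where
  "tape_star C P Q = cls C (bangw P) \<odot>\<^bsub>tape_category C\<^esub> cls C (cobangw Q)"

definition tape_plus :: "('o, 'a, 'm) category_scheme \<Rightarrow> real \<Rightarrow>
    ('o, 'a) tape set \<Rightarrow> ('o, 'a) tape set \<Rightarrow> ('o, 'a) tape set" where
  "tape_plus C p f g =
     cls C (splitw p (Dom (tape_category C) f)) \<odot>\<^bsub>tape_category C\<^esub> tape_par C f g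
       \<odot>\<^bsub>tape_category C\<^esub> cls C (mergew (Cod (tape_category C) f))"

definition tape_projs :: "('o, 'a, 'm) category_scheme \<Rightarrow> 'o list \<Rightarrow> ('o, 'a) tape set list" where
  "tape_projs C Us =
     map (\<lambda>i. cls C (bangw (take i Us) \<oplus> IdO (Us ! i) \<oplus> bangw (drop (Suc i) Us))) [0..<length Us]"

end

(* The convex product condition requires an arrow to be determined by its projections. The laws
   directly show only that half of it is a convex combination of them, and the halving must then be
   cancelled. We therefore interpret a tape P -> Q as a linear map from lists of functionals on Q to
   lists of functionals on P, a functional on U being evaluated at real functions of the arrows out
   of U. The interpretation is faithful: an arrow out of a word is determined by its restrictions to
   the letters; an arrow U -> Q lies in the convex span of the generators "c followed by the j-th
   injection"; such a span is free as soon as affine functions read off the weights of the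
   generators; and the interpretation, evaluated at Dirac functionals, provides these functions. All
   remaining equations and uniqueness claims reduce to linear algebra. *)

theory Submission
  imports Defs
begin

text \<open>Cancelling the half is no formality. In a general pca, equal proper multiples of
  \<open>x\<close> and \<open>y\<close> do not give \<open>x = y\<close>: in a semilattice with
  bottom \<open>star\<close>, where every proper combination is the meet, all proper multiples of
  all elements are \<open>star\<close>. It works for arrows out of a letter because these hom-sets
  turn out to be free, and freeness must be established against a presentation, where syntax yields
  only a spanning set. The interpretation supplies the independence. It is the regular
  representation of C made linear: evaluation at the identity of V is sent by \<open>c\<close> from
  U to V to evaluation at \<open>c\<close>, so distinct generators act differently whatever C is.
  Functionals instead of formal convex sums turn the laws into pointwise identities of reals, with
  no finite supports to carry: read backwards, splitting is a weighted sum, merging duplicates an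
  entry and discarding inserts zero. The pca enrichment is still proved equationally, since the
  spans are formed with its operations and faithfulness is derived from them.\<close>

declare in_lists_conv_set [simp del] in_listsD [rule del] in_listsI [rule del]

section \<open>Typing of the structural terms\<close>

lemma typed_words [simp]:
  "typed C (idw P) \<longleftrightarrow> P \<in> lists (Ob C)" "src C (idw P) = P" "tgt C (idw P) = P"
  "typed C (bangw P) \<longleftrightarrow> P \<in> lists (Ob C)" "src C (bangw P) = P" "tgt C (bangw P) = []"
  "typed C (cobangw P) \<longleftrightarrow> P \<in> lists (Ob C)" "src C (cobangw P) = []" "tgt C (cobangw P) = P"
  by (induction P) auto

lemma typed_swap1 [simp]:
  "src C (swap1 U Q) = U # Q" "tgt C (swap1 U Q) = Q @ [U]"
  "typed C (swap1 U Q) \<longleftrightarrow> U \<in> Ob C \<and> Q \<in> lists (Ob C)"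
  by (induction Q) auto

lemma typed_swapw [simp]:
  "src C (swapw P Q) = P @ Q" "tgt C (swapw P Q) = Q @ P"
  "typed C (swapw P Q) \<longleftrightarrow> P \<in> lists (Ob C) \<and> Q \<in> lists (Ob C)"
  by (induction P) auto

lemma typed_splitw [simp]:
  "src C (splitw p P) = P" "tgt C (splitw p P) = P @ P"
  "0 < p \<Longrightarrow> p < 1 \<Longrightarrow> typed C (splitw p P) \<longleftrightarrow> P \<in> lists (Ob C)"
  by (induction P) auto

lemma typed_mergew [simp]:
  "src C (mergew P) = P @ P" "tgt C (mergew P) = P"
  "typed C (mergew P) \<longleftrightarrow> P \<in> lists (Ob C)"
  by (induction P) auto

text \<open>Because \<open>1 - p * q = p * (1 - q) + (1 - p)\<close>, the reassociated weight is a
  proper fraction. This keeps the right-hand side of \<open>split_assoc\<close> well typed.\<close>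

lemma split_weight_bounds:
  fixes p q :: real
  assumes "0 < p" "p < 1" "0 < q" "q < 1"
  shows "0 < p * q" "p * q < 1" "0 < p * (1 - q) / (1 - p * q)" "p * (1 - q) / (1 - p * q) < 1"
proof -
  show "0 < p * q" using assms by simp
  show *: "p * q < 1" using assms by (smt (verit) mult_le_cancel_right2)
  then show "0 < p * (1 - q) / (1 - p * q)" using assms by simp
  show "p * (1 - q) / (1 - p * q) < 1" using * assms by (simp add: field_simps)
qed

context category
begin

lemma typed_words_ob: "typed C t \<Longrightarrow> src C t \<in> lists (Ob C) \<and> tgt C t \<in> lists (Ob C)"
  by (induction t) (auto simp: dom_ob cod_ob)

lemmas src_ob = typed_words_ob[THEN conjunct1] and tgt_ob = typed_words_ob[THEN conjunct2]

lemma teq_typed: "teq C s t \<Longrightarrow> typed C s \<and> typed C t \<and> src C s = src C t \<and> tgt C s = tgt C t"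
proof (induction rule: teq.induct)
  case (gen_id U)
  then show ?case using ident_hom by (auto simp: hom_def)
next
  case (gen_cmp c U V d W)
  then show ?case using cmp_hom by (auto simp: hom_def)
next
  case (split_assoc p q P)
  then show ?case using split_weight_bounds by simp
qed (auto simp: tm_def src_ob tgt_ob)

end

section \<open>The linear interpretation of terms\<close>

text \<open>A term \<open>t\<close> acts contravariantly, from lists over \<open>tgt C t\<close> to lists over \<open>src C t\<close>; on lists of
  the wrong length the value is junk.\<close>

primrec sem :: "('o, 'a, 'm) category_scheme \<Rightarrow> ('o, 'a) tape \<Rightarrow>
    (('a \<Rightarrow> real) \<Rightarrow> real) list \<Rightarrow> (('a \<Rightarrow> real) \<Rightarrow> real) list" where
  "sem C (Split p U) xs = [\<lambda>\<phi>. p * (xs ! 0) \<phi> + (1 - p) * (xs ! 1) \<phi>]"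
| "sem C (Bang U) xs = [\<lambda>\<phi>. 0]"
| "sem C (Merge U) xs = [xs ! 0, xs ! 0]"
| "sem C (Cobang U) xs = []"
| "sem C (Swap U V) xs = [xs ! 1, xs ! 0]"
| "sem C (IdO U) xs = [xs ! 0]"
| "sem C IdZ xs = []"
| "sem C (Gen c) xs = [\<lambda>\<phi>. (xs ! 0) (\<lambda>e. \<phi> (c \<odot>\<^bsub>C\<^esub> e))]"
| "sem C (s ;; t) xs = sem C s (sem C t xs)"
| "sem C (s \<oplus> t) xs =
     sem C s (take (length (tgt C s)) xs) @ sem C t (drop (length (tgt C s)) xs)"

lemma length_sem [simp]: "length (sem C t xs) = length (src C t)"
  by (induction t arbitrary: xs) auto

section \<open>Linearity of the interpretation\<close>

definition lincomb :: "real \<Rightarrow> real \<Rightarrow> ('b \<Rightarrow> real) list \<Rightarrow> ('b \<Rightarrow> real) list \<Rightarrow> ('b \<Rightarrow> real) list" where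
  "lincomb a b xs ys = map2 (\<lambda>x y \<phi>. a * x \<phi> + b * y \<phi>) xs ys"

lemma length_lincomb [simp]: "length (lincomb a b xs ys) = min (length xs) (length ys)"
  by (simp add: lincomb_def)

lemma nth_lincomb [simp]:
  "i < length xs \<Longrightarrow> i < length ys \<Longrightarrow> lincomb a b xs ys ! i = (\<lambda>\<phi>. a * (xs ! i) \<phi> + b * (ys ! i) \<phi>)"
  by (simp add: lincomb_def)

lemma lincomb_Nil [simp]: "lincomb a b [] ys = []" "lincomb a b xs [] = []"
  by (simp_all add: lincomb_def)

lemma lincomb_Cons [simp]:
  "lincomb a b (x # xs) (y # ys) = (\<lambda>\<phi>. a * x \<phi> + b * y \<phi>) # lincomb a b xs ys"
  by (simp add: lincomb_def)

lemma lincomb_append: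
  "length xs = length ys \<Longrightarrow>
   lincomb a b (xs @ xs') (ys @ ys') = lincomb a b xs ys @ lincomb a b xs' ys'"
  by (simp add: lincomb_def)

lemma lincomb_replicate_zero [simp]:
  "lincomb a b (replicate n (\<lambda>_. 0)) (replicate n (\<lambda>_. 0)) = replicate n (\<lambda>_. 0)"
  by (induction n) auto

lemma take_lincomb: "take n (lincomb a b xs ys) = lincomb a b (take n xs) (take n ys)"
  and drop_lincomb: "drop n (lincomb a b xs ys) = lincomb a b (drop n xs) (drop n ys)"
  by (simp_all add: lincomb_def take_map drop_map take_zip drop_zip)

text \<open>Linearity has two uses: it is the semantic form of naturality of splitting, and it later
  allows a valuation to be cut into pieces supported on one factor.\<close>

lemma sem_lincomb:
  "typed C t \<Longrightarrow> length xs = length (tgt C t) \<Longrightarrow> length ys = length (tgt C t) \<Longrightarrow>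
   sem C t (lincomb a b xs ys) = lincomb a b (sem C t xs) (sem C t ys)"
proof (induction t arbitrary: xs ys)
  case (Par s t)
  then show ?case by (simp add: take_lincomb drop_lincomb lincomb_append)
qed (auto simp: algebra_simps)

lemma sem_zero:
  assumes "typed C t"
  shows "sem C t (replicate (length (tgt C t)) (\<lambda>_. 0)) = replicate (length (src C t)) (\<lambda>_. 0)"
proof -
  let ?z = "replicate (length (tgt C t)) (\<lambda>_. 0)"
  have "sem C t ?z = sem C t (lincomb 0 0 ?z ?z)" by simp
  also have "\<dots> = lincomb 0 0 (sem C t ?z) (sem C t ?z)" by (rule sem_lincomb) (use assms in auto)
  also have "\<dots> = replicate (length (src C t)) (\<lambda>_. 0)" by (rule nth_equalityI) auto
  finally show ?thesis .
qed

lemma sem_par_append [simp]: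
  "length xs = length (tgt C s) \<Longrightarrow> sem C (s \<oplus> t) (xs @ ys) = sem C s xs @ sem C t ys"
  by simp

text \<open>The raw equation would unfold every parallel composition into \<open>take\<close> and
  \<open>drop\<close>. From here on the input is first written as an explicit concatenation.\<close>

declare sem.simps(10) [simp del]

section \<open>Values of the structural terms\<close>

lemma sem_par_Cons:
  "length (tgt C s) = 1 \<Longrightarrow> sem C (s \<oplus> t) (x # xs) = sem C s [x] @ sem C t xs"
  using sem_par_append[of "[x]" C s t xs] by simp

lemma sem_idw [simp]: "length xs = length P \<Longrightarrow> sem C (idw P) xs = xs"
  by (induction P arbitrary: xs) (auto simp: length_Suc_conv sem_par_Cons)

lemma sem_bangw [simp]: "sem C (bangw P) xs = replicate (length P) (\<lambda>_. 0)"
  by (induction P arbitrary: xs) (auto simp: sem.simps(10))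

lemma sem_cobangw [simp]: "sem C (cobangw P) xs = []"
  by (induction P arbitrary: xs) (auto simp: sem.simps(10))

text \<open>By contravariance the input is indexed by the target \<open>Q @ [U]\<close>, so the last
  entry moves to the front.\<close>

lemma sem_swap1 [simp]: "length ys = length Q \<Longrightarrow> sem C (swap1 U Q) (ys @ [x]) = x # ys"
proof (induction Q arbitrary: ys)
  case (Cons V Q)
  then obtain y zs where ys: "ys = y # zs" "length zs = length Q" by (auto simp: length_Suc_conv)
  have "sem C (Swap U V \<oplus> idw Q) ([y, x] @ zs) = [x, y] @ zs"
    using ys by (subst sem_par_append) auto
  then show ?case using Cons.IH[of zs] ys by (simp add: sem_par_Cons)
qed auto

lemma sem_swapw [simp]:
  "length ys = length Q \<Longrightarrow> length xs = length P \<Longrightarrow> sem C (swapw P Q) (ys @ xs) = xs @ ys"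
proof (induction P arbitrary: xs)
  case (Cons U P)
  then obtain x zs where xs: "xs = x # zs" "length zs = length P" by (auto simp: length_Suc_conv)
  have "sem C (swap1 U Q \<oplus> idw P) ((ys @ [x]) @ zs) = (x # ys) @ zs"
    using Cons.prems xs by (subst sem_par_append) auto
  then show ?case using Cons.IH[of zs] Cons.prems xs by (simp add: sem_par_Cons)
qed auto

lemma sem_splitw [simp]:
  "length xs = length P \<Longrightarrow> length ys = length P \<Longrightarrow>
   sem C (splitw p P) (xs @ ys) = lincomb p (1 - p) xs ys"
proof (induction P arbitrary: xs ys)
  case (Cons U P)
  then obtain x xs' y ys' where xs: "xs = x # xs'" "length xs' = length P"
    and ys: "ys = y # ys'" "length ys' = length P" by (auto simp: length_Suc_conv)
  have "sem C (swapw [U] P \<oplus> idw P) ((xs' @ [y]) @ ys') = ([y] @ xs') @ ys'"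
    using xs ys by (subst sem_par_append) (simp_all del: swapw.simps)
  moreover have "sem C (Split p U \<oplus> splitw p P) ([x, y] @ (xs' @ ys')) =
      sem C (Split p U) [x, y] @ sem C (splitw p P) (xs' @ ys')"
    by (subst sem_par_append) auto
  ultimately show ?case using Cons.IH[of xs' ys'] xs ys by (simp add: sem_par_Cons del: swapw.simps)
qed auto

lemma sem_mergew [simp]: "length xs = length P \<Longrightarrow> sem C (mergew P) xs = xs @ xs"
proof (induction P arbitrary: xs)
  case (Cons U P)
  then obtain x xs' where xs: "xs = x # xs'" "length xs' = length P" by (auto simp: length_Suc_conv)
  have "sem C (swapw P [U] \<oplus> idw P) (([x] @ xs') @ xs') = (xs' @ [x]) @ xs'"
    using xs sem_swapw[of "[x]" "[U]" xs' P C] by (subst sem_par_append) auto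
  then show ?case using Cons.IH[of xs'] xs by (simp add: sem_par_Cons)
qed auto

text \<open>Only on these functionals is \<open>Gen (Ident C U)\<close> interpreted as the identity.\<close>

definition local_on :: "('o, 'a, 'm) category_scheme \<Rightarrow> 'o \<Rightarrow> (('a \<Rightarrow> real) \<Rightarrow> real) \<Rightarrow> bool" where
  "local_on C U x \<longleftrightarrow> (\<forall>\<phi> \<psi>. (\<forall>e\<in>Ar C. Dom C e = U \<longrightarrow> \<phi> e = \<psi> e) \<longrightarrow> x \<phi> = x \<psi>)"

abbreviation valuation :: "('o, 'a, 'm) category_scheme \<Rightarrow> 'o list \<Rightarrow>
    (('a \<Rightarrow> real) \<Rightarrow> real) list \<Rightarrow> bool" where
  "valuation C \<equiv> list_all2 (local_on C)"

lemma local_on_zero [simp]: "local_on C U (\<lambda>_. 0)"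
  by (simp add: local_on_def)

lemma local_on_lincomb:
  "local_on C U x \<Longrightarrow> local_on C U y \<Longrightarrow> local_on C U (\<lambda>\<phi>. a * x \<phi> + b * y \<phi>)"
  unfolding local_on_def by metis

lemma valuation_zero [simp]: "valuation C P (replicate (length P) (\<lambda>_. 0))"
  by (simp add: list_all2_conv_all_nth)

section \<open>Soundness of the interpretation\<close>

context category
begin

lemma valuation_sem: "typed C t \<Longrightarrow> valuation C (tgt C t) xs \<Longrightarrow> valuation C (src C t) (sem C t xs)"
proof (induction t arbitrary: xs)
  case (Gen c)
  then obtain x where x: "xs = [x]" "local_on C (Cod C c) x"
    by (auto simp: list_all2_Cons1)
  have "local_on C (Dom C c) (\<lambda>\<phi>. x (\<lambda>e. \<phi> (c \<odot> e)))"
    unfolding local_on_def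
  proof (intro allI impI)
    fix \<phi> \<psi> :: "'a \<Rightarrow> real" assume *: "\<forall>e\<in>Ar C. Dom C e = Dom C c \<longrightarrow> \<phi> e = \<psi> e"
    \<comment> \<open>An arrow out of the codomain of \<open>c\<close>, precomposed with
      \<open>c\<close>, starts at the domain of \<open>c\<close>, and that is where \<phi> and
      \<psi> agree.\<close>
    have "\<forall>e\<in>Ar C. Dom C e = Cod C c \<longrightarrow> \<phi> (c \<odot> e) = \<psi> (c \<odot> e)"
      using Gen.prems * cmp_hom by (auto simp: hom_def)
    then show "x (\<lambda>e. \<phi> (c \<odot> e)) = x (\<lambda>e. \<psi> (c \<odot> e))" using x(2) by (simp add: local_on_def)
  qed
  then show ?case by (simp add: x)
next
  case (Par s t)
  then show ?case by (auto simp: list_all2_append1[of _ "tgt C s"] intro!: list_all2_appendI)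
qed (auto simp: list_all2_Cons1 intro: local_on_lincomb)

text \<open>The laws \<open>gen_id\<close> and \<open>gen_cmp\<close> rest on category laws for
  composable arrows, hence the restriction to valuations; the remaining equations are identities
  between lists of the right length.\<close>

lemma teq_sem:
  "teq C s t \<Longrightarrow> valuation C (tgt C s) xs \<Longrightarrow> sem C s xs = sem C t xs"
proof (induction arbitrary: xs rule: teq.induct)
  case (sym s t)
  then show ?case using teq_typed by metis
next
  case (trans s t u)
  then show ?case using teq_typed by metis
next
  case (seq_cong s s' t t')
  \<comment> \<open>The first factor is evaluated at the value of the second, so its induction
    hypothesis asks for that value to be a valuation again.\<close>
  have "valuation C (tgt C s) (sem C t' xs)"
    using seq_cong teq_typed[OF seq_cong.hyps(2)] valuation_sem[of t' xs] by simp
  with seq_cong show ?case by simp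
next
  case (par_cong s s' t t')
  then show ?case using teq_typed[OF par_cong.hyps(1)] by (auto simp: list_all2_append1)
next
  case (par_assoc f g h)
  then obtain us vs ws where xs: "xs = us @ vs @ ws" "length us = length (tgt C f)"
    "length vs = length (tgt C g)" "length ws = length (tgt C h)"
    by (auto simp: list_all2_append1)
  have "sem C ((f \<oplus> g) \<oplus> h) ((us @ vs) @ ws) = (sem C f us @ sem C g vs) @ sem C h ws"
    using xs by (subst sem_par_append) auto
  then show ?case using xs by simp
next
  case (par_unit_left f)
  then show ?case by (simp add: sem.simps(10))
next
  case (par_unit_right f)
  then show ?case by (simp add: sem.simps(10) list_all2_lengthD)
next
  case (par_id P Q)
  then show ?case by (auto simp: list_all2_append1)
next
  case (interchange f P Q g R f' P' Q' g' R')
  then show ?case by (auto simp: list_all2_append1 tm_def)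
next
  case (swap_swap P Q)
  then show ?case by (auto simp: list_all2_append1)
next
  case (swap_nat f P Q g P' Q')
  then show ?case by (auto simp: list_all2_append1 tm_def)
next
  case (swap_unit P)
  then show ?case using sem_swapw[of "[]" "[]" xs P] by (simp add: list_all2_lengthD)
next
  case (swap_hexagon P Q R)
  then obtain r p q where xs: "xs = r @ p @ q" "length r = length R" "length p = length P" "length q = length Q"
    by (auto simp: list_all2_append1 dest!: list_all2_lengthD)
  have "sem C (swapw P R \<oplus> idw Q) ((r @ p) @ q) = (p @ r) @ q"
    using xs by (subst sem_par_append) auto
  moreover have "sem C (swapw (P @ Q) R) (r @ (p @ q)) = (p @ q) @ r"
    using xs by (subst sem_swapw) auto
  ultimately show ?case using xs by simp
next
  case (gen_id U)
  then obtain x where x: "xs = [x]" "local_on C U x"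
    using ident_hom by (auto simp: hom_def list_all2_Cons1)
  have "x (\<lambda>e. \<phi> (Ident C U \<odot> e)) = x \<phi>" for \<phi>
  proof -
    have "\<forall>e\<in>Ar C. Dom C e = U \<longrightarrow> \<phi> (Ident C U \<odot> e) = \<phi> e"
      using ident_left by (auto simp: hom_def)
    then show ?thesis using x(2) by (simp add: local_on_def)
  qed
  then show ?case by (simp add: x)
next
  case (gen_cmp c U V d W)
  then obtain x where x: "xs = [x]" "local_on C W x"
    using cmp_hom by (auto simp: hom_def list_all2_Cons1)
  have "x (\<lambda>e. \<phi> (c \<odot> d \<odot> e)) = x (\<lambda>e. \<phi> (c \<odot> (d \<odot> e)))" for \<phi>
  proof -
    have "\<forall>e\<in>Ar C. Dom C e = W \<longrightarrow> \<phi> (c \<odot> d \<odot> e) = \<phi> (c \<odot> (d \<odot> e))"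
      using cmp_assoc[OF gen_cmp(1,2)] by (auto simp: hom_def)
    then show ?thesis using x(2) by (simp add: local_on_def)
  qed
  then show ?case by (simp add: x)
next
  case (split_assoc p q P)
  let ?r = "p * (1 - q) / (1 - p * q)"
  from split_assoc obtain u v w where xs: "xs = (u @ v) @ w" "length u = length P" "length v = length P" "length w = length P"
    by (auto simp: list_all2_append1 dest!: list_all2_lengthD)
  have ne: "p * q \<noteq> 1" using split_weight_bounds(2) split_assoc by force
  have "sem C (splitw q P \<oplus> idw P) ((u @ v) @ w) = lincomb q (1 - q) u v @ w"
    using xs by (subst sem_par_append) auto
  moreover have "sem C (idw P \<oplus> splitw ?r P) (u @ (v @ w)) = u @ lincomb ?r (1 - ?r) v w"
    using xs by (subst sem_par_append) auto
  moreover have "lincomb p (1 - p) (lincomb q (1 - q) u v) w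
      = lincomb (p * q) (1 - p * q) u (lincomb ?r (1 - ?r) v w)"
  proof (rule nth_equalityI)
    fix i assume "i < length (lincomb p (1 - p) (lincomb q (1 - q) u v) w)"
    then have i: "i < length P" using xs by simp
    have r: "(1 - p * q) * ?r = p * (1 - q)" using ne by simp
    \<comment> \<open>Stated without division: \<open>r\<close> enters only through its product with
      \<open>1 - p * q\<close>.\<close>
    have key: "p * (q * a + (1 - q) * b) + (1 - p) * c =
        p * q * a + (1 - p * q) * (r * b + (1 - r) * c)"
      if "(1 - p * q) * r = p * (1 - q)" for a b c r
    proof -
      have "(1 - p * q) * (r * b + (1 - r) * c) =
          (1 - p * q) * r * b + (1 - p * q - (1 - p * q) * r) * c"
        by (simp add: algebra_simps)
      then show ?thesis unfolding that by (simp add: algebra_simps)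
    qed
    have "lincomb p (1 - p) (lincomb q (1 - q) u v) w ! i =
        (\<lambda>\<phi>. p * (q * (u ! i) \<phi> + (1 - q) * (v ! i) \<phi>) + (1 - p) * (w ! i) \<phi>)"
      using i xs by simp
    also have "\<dots> =
         (\<lambda>\<phi>. p * q * (u ! i) \<phi> + (1 - p * q) * (?r * (v ! i) \<phi> + (1 - ?r) * (w ! i) \<phi>))"
      by (rule ext, rule key[OF r])
    also have "\<dots> = lincomb (p * q) (1 - p * q) u (lincomb ?r (1 - ?r) v w) ! i"
      using i xs by simp
    finally show "lincomb p (1 - p) (lincomb q (1 - q) u v) w ! i =
        lincomb (p * q) (1 - p * q) u (lincomb ?r (1 - ?r) v w) ! i" .
  qed (simp add: xs)
  ultimately show ?case using xs by simp
next
  case (split_merge p P)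
  then show ?case by (auto intro!: nth_equalityI simp: algebra_simps list_all2_lengthD)
next
  case (split_comm p P)
  then show ?case
    by (auto simp: list_all2_append1 algebra_simps intro!: nth_equalityI dest!: list_all2_lengthD)
next
  case (bang_nat f P Q)
  then show ?case using sem_zero[of C f] by (auto simp: tm_def)
next
  case (cobang_nat f P Q)
  then show ?case by (auto simp: tm_def list_all2_lengthD)
next
  case (merge_nat f P Q)
  then show ?case by (auto simp: tm_def list_all2_lengthD)
next
  case (split_nat p f P Q)
  then show ?case by (auto simp: tm_def list_all2_append1 sem_lincomb dest!: list_all2_lengthD)
next
  case (merge_comm P)
  then show ?case by (auto simp: list_all2_lengthD)
next
  case (merge_assoc P)
  then show ?case by (auto simp: list_all2_lengthD)
next
  case (merge_unit P)
  then show ?case using sem_par_append[of "[]" C "cobangw P"] 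
    by (auto simp: list_all2_lengthD)
qed (auto simp: tm_def list_all2_lengthD)

end

section \<open>Free pointed convex algebras\<close>

context pca
begin

lemma ext_plus_closed:
  "0 \<le> p \<Longrightarrow> p \<le> 1 \<Longrightarrow> x \<in> S \<Longrightarrow> y \<in> S \<Longrightarrow> ext_plus cvx p x y \<in> S"
  using plus_closed[of p x y] by (auto simp: ext_plus_def)

lemma ext_plus_comm:
  "0 \<le> p \<Longrightarrow> p \<le> 1 \<Longrightarrow> x \<in> S \<Longrightarrow> y \<in> S \<Longrightarrow> ext_plus cvx p x y = ext_plus cvx (1 - p) y x"
  using plus_comm[of p x y] by (auto simp: ext_plus_def)

lemma ext_plus_idem: "0 \<le> p \<Longrightarrow> p \<le> 1 \<Longrightarrow> x \<in> S \<Longrightarrow> ext_plus cvx p x x = x"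
  using plus_idem[of p x] by (auto simp: ext_plus_def)

text \<open>At an endpoint both sides collapse to at most one proper combination;
  \<open>p * q \<noteq> 1\<close> keeps the denominator of the new weight non-zero.\<close>

lemma ext_plus_assoc:
  assumes "0 \<le> p" "p \<le> 1" "0 \<le> q" "q \<le> 1" "p * q \<noteq> 1" "x \<in> S" "y \<in> S" "z \<in> S"
  shows "ext_plus cvx p (ext_plus cvx q x y) z
    = ext_plus cvx (p * q) x (ext_plus cvx (p * (1 - q) / (1 - p * q)) y z)"
proof -
  consider "p = 0" | "p = 1" | "q = 0" | "q = 1" "p < 1" "0 < p" | "0 < p" "p < 1" "0 < q" "q < 1"
    using assms by linarith
  then show ?thesis
  proof cases
    case 5
    then have "p * q < 1" by (smt (verit) mult_le_cancel_right2)
    \<comment> \<open>For weights in the open interval the new inner weight avoids both endpoints,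
      so every \<open>ext_plus\<close> here is \<open>cvx\<close>.\<close>
    moreover have "p * (1 - q) / (1 - p * q) \<noteq> 1" "p * (1 - q) / (1 - p * q) \<noteq> 0"
      using 5 \<open>p * q < 1\<close> by (simp_all add: field_simps)
    ultimately show ?thesis
      using 5 plus_assoc[of p q x y z] assms by (simp add: ext_plus_def)
  qed (use assms in \<open>auto simp: ext_plus_def\<close>)
qed

end

text \<open>Generation by binary combinations, so that rule induction replaces any handling of
  formal convex sums.\<close>

inductive_set cvx_span :: "'a \<Rightarrow> (real \<Rightarrow> 'a \<Rightarrow> 'a \<Rightarrow> 'a) \<Rightarrow> 'a set \<Rightarrow> 'a set"
  for star cvx G where
  star: "star \<in> cvx_span star cvx G"
| gen: "x \<in> G \<Longrightarrow> x \<in> cvx_span star cvx G"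
| plus: "0 < p \<Longrightarrow> p < 1 \<Longrightarrow> x \<in> cvx_span star cvx G \<Longrightarrow> y \<in> cvx_span star cvx G \<Longrightarrow>
    cvx p x y \<in> cvx_span star cvx G"

lemma cvx_span_mono: "x \<in> cvx_span star cvx G \<Longrightarrow> G \<subseteq> H \<Longrightarrow> x \<in> cvx_span star cvx H"
  by (induction rule: cvx_span.induct) (auto intro: cvx_span.intros)

lemma cvx_span_ext_plus:
  "0 \<le> p \<Longrightarrow> p \<le> 1 \<Longrightarrow> x \<in> cvx_span star cvx G \<Longrightarrow> y \<in> cvx_span star cvx G \<Longrightarrow>
   ext_plus cvx p x y \<in> cvx_span star cvx G"
  using cvx_span.plus[of p x star cvx G y] by (auto simp: ext_plus_def)

text \<open>Reduces freeness over infinitely many generators to an induction on a finite set of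
  them.\<close>

lemma cvx_span_finite:
  "x \<in> cvx_span star cvx G \<Longrightarrow> \<exists>F. finite F \<and> F \<subseteq> G \<and> x \<in> cvx_span star cvx F"
proof (induction rule: cvx_span.induct)
  case star
  then show ?case by (auto intro!: exI[of _ "{}"] cvx_span.star)
next
  case (gen x)
  then show ?case by (auto intro!: exI[of _ "{x}"] cvx_span.gen)
next
  case (plus p x y)
  then obtain F F' where "finite F" "F \<subseteq> G" "x \<in> cvx_span star cvx F"
    "finite F'" "F' \<subseteq> G" "y \<in> cvx_span star cvx F'" by blast
  then show ?case using plus(1,2)
    by (intro exI[of _ "F \<union> F'"]) (auto intro!: cvx_span.plus elim: cvx_span_mono)
qed

context pca
begin

lemma cvx_span_subset: "G \<subseteq> S \<Longrightarrow> cvx_span star cvx G \<subseteq> S"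
proof
  fix x assume "x \<in> cvx_span star cvx G" "G \<subseteq> S"
  then show "x \<in> S"
    by (induction rule: cvx_span.induct) (auto intro: star_closed plus_closed)
qed

text \<open>Rebracketing brings the copies of \<open>a\<close> to the front and idempotence merges
  them, leaving a remainder spanned by \<open>G\<close> alone. Only the pca laws are used, no
  cancellation.\<close>

lemma split_off_generator:
  assumes a: "a \<in> S" and G: "G \<subseteq> S" and "x \<in> cvx_span star cvx (insert a G)"
  shows "\<exists>p\<ge>0. p \<le> 1 \<and> (\<exists>y\<in>cvx_span star cvx G. x = ext_plus cvx p a y)"
  using assms(3)
proof (induction rule: cvx_span.induct)
  case star
  then show ?case
    by (auto intro!: exI[of _ 0] bexI[of _ star] cvx_span.star simp: ext_plus_def)
next
  case (gen x)
  show ?case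
  proof (cases "x = a")
    case True
    then show ?thesis
      by (auto intro!: exI[of _ 1] bexI[of _ star] cvx_span.star simp: ext_plus_def)
  next
    case False
    with gen show ?thesis
      by (auto intro!: exI[of _ 0] bexI[of _ x] cvx_span.gen simp: ext_plus_def)
  qed
next
  case (plus q x x')
  then obtain p y r z where x: "x = ext_plus cvx p a y" "0 \<le> p" "p \<le> 1" "y \<in> cvx_span star cvx G"
    and x': "x' = ext_plus cvx r a z" "0 \<le> r" "r \<le> 1" "z \<in> cvx_span star cvx G" by auto
  note mem = subsetD[OF cvx_span_subset[OF G]]
  \<comment> \<open>In the mixture, \<open>m\<close> is the weight of the \<open>a\<close> inside
    \<open>x\<close>, and \<open>u\<close> is the relative weight of \<open>y\<close> in what is
    left once that \<open>a\<close> stands in front.\<close>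
  define m where "m = q * p"
  define u where "u = q * (1 - p) / (1 - m)"
  have m: "0 \<le> m" "m < 1" using plus x unfolding m_def by (auto, smt (verit) mult_le_cancel_left2)
  have "q * (1 - p) \<le> 1 - m" using plus by (simp add: m_def algebra_simps)
  then have u: "0 \<le> u" "u \<le> 1" using m plus x by (auto simp: u_def)
  have "cvx q x x' = ext_plus cvx q (ext_plus cvx p a y) x'"
    using plus x by (simp add: ext_plus_def)
  also have "\<dots> = ext_plus cvx m a (ext_plus cvx u y x')"
    unfolding m_def u_def by (rule ext_plus_assoc)
      (use plus x x' m a mem in \<open>auto simp: m_def intro!: ext_plus_closed\<close>)
  also have "ext_plus cvx u y x' = ext_plus cvx (1 - u) x' y"
    by (rule ext_plus_comm) (use u x x' a mem in \<open>auto intro!: ext_plus_closed\<close>)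
  finally have eq: "cvx q x x' = ext_plus cvx m a (ext_plus cvx (1 - u) x' y)" .
  show ?case
  proof (cases "(1 - u) * r = 1")
    \<comment> \<open>Here \<open>u = 0\<close> and \<open>r = 1\<close>, so \<open>x'\<close> is
      \<open>a\<close> and the whole mixture collapses to \<open>a\<close>. Otherwise associativity
      applies a second time with a non-zero denominator.\<close>
    case True
    then have "u = 0" using u x' by (smt (verit) mult_left_le mult_nonneg_nonneg)
    with True have "r = 1" by simp
    then have "cvx q x x' = a"
      using eq \<open>u = 0\<close> x' m a ext_plus_idem[of m a] by (simp add: ext_plus_def)
    then show ?thesis
      by (auto intro!: exI[of _ 1] bexI[of _ star] cvx_span.star simp: ext_plus_def)
  next
    case False
    \<comment> \<open>The copy of \<open>a\<close> inside \<open>x'\<close> is brought forward with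
      relative weight \<open>v\<close>, and \<open>e\<close> collects the remainders
      \<open>z\<close> and \<open>y\<close>.\<close>
    define v where "v = (1 - u) * r"
    define w where "w = (1 - u) * (1 - r) / (1 - v)"
    have v: "0 \<le> v" "v < 1"
      using False u x' mult_le_one[of "1 - u" r] by (auto simp: v_def less_le)
    have "(1 - u) * (1 - r) \<le> 1 - v" using u by (simp add: v_def algebra_simps)
    then have w: "0 \<le> w" "w \<le> 1" using v u x' by (auto simp: w_def)
    define e where "e = ext_plus cvx w z y"
    have e: "e \<in> cvx_span star cvx G" unfolding e_def using w x x' by (intro cvx_span_ext_plus)
    have eq2: "ext_plus cvx (1 - u) x' y = ext_plus cvx v a e"
      unfolding x' v_def w_def e_def by (rule ext_plus_assoc)
        (use u x x' a mem False in \<open>auto intro!: ext_plus_closed\<close>)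
    \<comment> \<open>Associativity read backwards merges the two copies: \<open>s\<close> is the
      total weight of \<open>a\<close> and \<open>k\<close> the share of it due to the first copy.
      If \<open>s = 0\<close>, both copies have weight zero and only \<open>e\<close>
      remains.\<close>
    define s where "s = m + v * (1 - m)"
    define k where "k = m / s"
    have "v * (1 - m) \<le> 1 - m" using m v mult_right_mono[of v 1 "1 - m"] by simp
    then have s: "0 \<le> s" "s \<le> 1" "m \<le> s"
      using m v mult_nonneg_nonneg[of v "1 - m"] unfolding s_def by linarith+
    show ?thesis
    proof (cases "s = 0")
      case True
      then have "m = 0" using m s by simp
      with True have "v = 0" by (simp add: s_def)
      then have "cvx q x x' = ext_plus cvx 0 a e" using eq eq2 \<open>m = 0\<close> by (simp add: ext_plus_def)
      then show ?thesis using e by (intro exI[of _ 0]) auto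
    next
      case False
      have k: "0 \<le> k" "k \<le> 1" "s * k = m" using m s False by (auto simp: k_def)
      have "s * (1 - k) / (1 - s * k) = v"
        using m k by (simp add: right_diff_distrib k(3)) (simp add: s_def field_simps)
      then have "ext_plus cvx s (ext_plus cvx k a a) e = ext_plus cvx m a (ext_plus cvx v a e)"
        using ext_plus_assoc[of s k a a e] s k m a e mem by auto
      then have "cvx q x x' = ext_plus cvx s a e" using eq eq2 k a by (simp add: ext_plus_idem)
      then show ?thesis using e s by auto
    qed
  qed
qed

text \<open>Splitting off the generators one at a time, their weights being read off by \<open>w\<close>.\<close>

lemma eq_if_weights_eq_finite:
  assumes "finite K" "\<And>k. k \<in> K \<Longrightarrow> g k \<in> S"
    and w_star: "\<And>k. k \<in> K \<Longrightarrow> w k star = 0"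
    and w_plus: "\<And>k p x y. k \<in> K \<Longrightarrow> 0 < p \<Longrightarrow> p < 1 \<Longrightarrow> x \<in> S \<Longrightarrow> y \<in> S \<Longrightarrow>
      w k (cvx p x y) = p * w k x + (1 - p) * w k y"
    and w_gen: "\<And>k l. k \<in> K \<Longrightarrow> l \<in> K \<Longrightarrow> w k (g l) = (if k = l then 1 else (0::real))"
    and "x \<in> cvx_span star cvx (g ` K)" "y \<in> cvx_span star cvx (g ` K)"
    and "\<And>k. k \<in> K \<Longrightarrow> w k x = w k y"
  shows "x = y"
  using assms
proof (induction K arbitrary: x y rule: finite_induct)
  case empty
  have "z = star" if "z \<in> cvx_span star cvx {}" for z
    using that by (induction rule: cvx_span.induct) (auto simp: plus_idem star_closed)
  with empty show ?case by auto
next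
  case (insert k K)
  have span_insert: "cvx_span star cvx (g ` insert k K) = cvx_span star cvx (insert (g k) (g ` K))"
    by simp
  have gS: "g ` K \<subseteq> S" "g k \<in> S" using insert.prems(1) by auto
  note mem = subsetD[OF cvx_span_subset[OF gS(1)]]
  obtain p x' where x: "0 \<le> p" "p \<le> 1" "x' \<in> cvx_span star cvx (g ` K)" "x = ext_plus cvx p (g k) x'"
    using split_off_generator[OF gS(2,1) insert.prems(5)[unfolded span_insert]] by auto
  obtain q y' where y: "0 \<le> q" "q \<le> 1" "y' \<in> cvx_span star cvx (g ` K)" "y = ext_plus cvx q (g k) y'"
    using split_off_generator[OF gS(2,1) insert.prems(6)[unfolded span_insert]] by auto
  have w_ext: "w l (ext_plus cvx r (g k) z) = r * w l (g k) + (1 - r) * w l z"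
    if "l \<in> insert k K" "0 \<le> r" "r \<le> 1" "z \<in> S" for l r z
    using that insert.prems(3)[of l r "g k" z] gS by (auto simp: ext_plus_def)
  \<comment> \<open>The weight of the new generator vanishes on the span of the old ones, so
    \<open>w k\<close> reads off exactly the coefficient that was split off.\<close>
  have w0: "w k z = 0" if "z \<in> cvx_span star cvx (g ` K)" for z
    using that
  proof (induction rule: cvx_span.induct)
    case star
    then show ?case using insert.prems(2) by simp
  next
    case (gen z)
    then show ?case using insert.prems(4) insert.hyps(2) by auto
  next
    case (plus p x y)
    then show ?case using insert.prems(3)[of k p x y] mem by simp
  qed
  have "w k x = p" "w k y = q"
    using w_ext[of k p x'] w_ext[of k q y'] w0 x y mem insert.prems(4)[of k k] by auto
  then have pq: "p = q" using insert.prems(7)[of k] by simp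
  show ?case
  \<comment> \<open>For \<open>p = 1\<close> the remainders are invisible and both elements are
    \<open>g k\<close>. Otherwise dividing by \<open>1 - p\<close> passes the equality of weights on
    to the remainders.\<close>
  proof (cases "p = 1")
    case True
    then show ?thesis using x y pq by (simp add: ext_plus_def)
  next
    case False
    have "x' = y'"
    proof (rule insert.IH)
      fix l assume l: "l \<in> K"
      then have "l \<noteq> k" using insert.hyps(2) by auto
      then have "w l x = (1 - p) * w l x'" "w l y = (1 - p) * w l y'"
        using w_ext[of l p x'] w_ext[of l p y'] x y mem insert.prems(4)[of l k] l pq by auto
      then show "w l x' = w l y'" using insert.prems(7)[of l] l False by simp
    qed (use x y insert.prems in auto)
    then show ?thesis using x y pq by simp
  qed
qed

text \<open>The functions \<open>w\<close> act as a dual basis: a spanning family that has one is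
  free. Both elements lie in the span of one common finite part.\<close>

lemma eq_if_weights_eq:
  assumes g: "\<And>k. k \<in> K \<Longrightarrow> g k \<in> S"
    and "\<And>k. k \<in> K \<Longrightarrow> w k star = 0"
    and "\<And>k p x y. k \<in> K \<Longrightarrow> 0 < p \<Longrightarrow> p < 1 \<Longrightarrow> x \<in> S \<Longrightarrow> y \<in> S \<Longrightarrow>
      w k (cvx p x y) = p * w k x + (1 - p) * w k y"
    and "\<And>k l. k \<in> K \<Longrightarrow> l \<in> K \<Longrightarrow> w k (g l) = (if k = l then 1 else (0::real))"
    and x: "x \<in> cvx_span star cvx (g ` K)" and y: "y \<in> cvx_span star cvx (g ` K)"
    and "\<And>k. k \<in> K \<Longrightarrow> w k x = w k y"
  shows "x = y"
proof -
  obtain F where F: "finite F" "F \<subseteq> g ` K" "x \<in> cvx_span star cvx F" "y \<in> cvx_span star cvx F"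
  proof -
    obtain F1 F2 where "finite F1" "F1 \<subseteq> g ` K" "x \<in> cvx_span star cvx F1"
      "finite F2" "F2 \<subseteq> g ` K" "y \<in> cvx_span star cvx F2"
      using cvx_span_finite[OF x] cvx_span_finite[OF y] by auto
    then show ?thesis
      by (intro that[of "F1 \<union> F2"]) (auto elim: cvx_span_mono)
  qed
  then obtain L where L: "L \<subseteq> K" "finite L" "F = g ` L" using finite_subset_image by metis
  show ?thesis
    by (rule eq_if_weights_eq_finite[of L g w]) (use assms F L in \<open>auto simp: subset_iff\<close>)
qed

end

section \<open>Equational laws of the tape category\<close>

context category
begin

section \<open>Classes of terms and the operations on them\<close>

lemma cls_eq_iff: "typed C s \<Longrightarrow> cls C s = cls C t \<longleftrightarrow> teq C s t"
  unfolding cls_def by (auto intro: teq.intros)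

lemma teq_rep: "typed C t \<Longrightarrow> teq C t (rep (cls C t))"
  unfolding rep_def by (rule someI2[of _ t]) (auto simp: cls_def intro: teq.refl)

lemma rep_simps [simp]:
  "typed C t \<Longrightarrow> typed C (rep (cls C t))"
  "typed C t \<Longrightarrow> src C (rep (cls C t)) = src C t"
  "typed C t \<Longrightarrow> tgt C (rep (cls C t)) = tgt C t"
  using teq_typed[OF teq_rep[of t]] by auto

abbreviation tape_cmp (infixl "\<cdot>" 65) where "X \<cdot> Y \<equiv> X \<odot>\<^bsub>tape_category C\<^esub> Y"
abbreviation tape_tensor (infixr "\<otimes>" 70) where "X \<otimes> Y \<equiv> tape_par C X Y"
abbreviation arr where "arr X \<equiv> X \<in> Ar (tape_category C)"
abbreviation td where "td \<equiv> Dom (tape_category C)"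
abbreviation tc where "tc \<equiv> Cod (tape_category C)"

lemma tape_Ob [simp]: "Ob (tape_category C) = lists (Ob C)"
  and tape_Ident [simp]: "Ident (tape_category C) = (\<lambda>P. cls C (idw P))"
  by (simp_all add: tape_category_def)

lemma arr_cls [simp]: "typed C t \<Longrightarrow> arr (cls C t)"
  and td_cls [simp]: "typed C t \<Longrightarrow> td (cls C t) = src C t"
  and tc_cls [simp]: "typed C t \<Longrightarrow> tc (cls C t) = tgt C t"
  by (simp_all add: tape_category_def)

lemma arrE: assumes "arr X" obtains t where "typed C t" "X = cls C t"
  using assms by (auto simp: tape_category_def)

lemma cmp_cls [simp]:
  assumes "typed C s" "typed C t" "tgt C s = src C t"
  shows "cls C s \<cdot> cls C t = cls C (s ;; t)"
  using assms teq_rep[of s] teq_rep[of t]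
  by (simp add: tape_category_def cls_eq_iff teq.seq_cong teq.sym)

lemma par_cls [simp]:
  assumes "typed C s" "typed C t"
  shows "cls C s \<otimes> cls C t = cls C (s \<oplus> t)"
  using assms teq_rep[of s] teq_rep[of t]
  by (simp add: tape_par_def cls_eq_iff teq.par_cong teq.sym)

lemma cmp_simps [simp]:
  assumes "arr X" "arr Y" "tc X = td Y"
  shows "arr (X \<cdot> Y)" "td (X \<cdot> Y) = td X" "tc (X \<cdot> Y) = tc Y"
  using assms by (auto elim!: arrE)

lemma par_simps [simp]:
  assumes "arr X" "arr Y"
  shows "arr (X \<otimes> Y)" "td (X \<otimes> Y) = td X @ td Y" "tc (X \<otimes> Y) = tc X @ tc Y"
  using assms by (auto elim!: arrE)

lemma td_ob [simp]: "arr X \<Longrightarrow> td X \<in> lists (Ob C)"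
  and tc_ob [simp]: "arr X \<Longrightarrow> tc X \<in> lists (Ob C)"
  by (elim arrE, simp add: src_ob tgt_ob)+

abbreviation I where "I P \<equiv> cls C (idw P)"
abbreviation sw where "sw P Q \<equiv> cls C (swapw P Q)"
abbreviation br where "br P \<equiv> cls C (bangw P)"
abbreviation cb where "cb P \<equiv> cls C (cobangw P)"
abbreviation sp where "sp p P \<equiv> cls C (splitw p P)"
abbreviation mg where "mg P \<equiv> cls C (mergew P)"

lemma cls_eqI: "teq C s t \<Longrightarrow> cls C s = cls C t"
  using teq_typed cls_eq_iff by blast

lemma tape_assoc:
  "arr X \<Longrightarrow> arr Y \<Longrightarrow> arr Z \<Longrightarrow> tc X = td Y \<Longrightarrow> tc Y = td Z \<Longrightarrow> X \<cdot> Y \<cdot> Z = X \<cdot> (Y \<cdot> Z)"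
  by ((elim arrE, simp add: cls_eq_iff src_ob tgt_ob), (rule seq_assoc; simp add: tm_def))

lemma tape_id_left: "arr X \<Longrightarrow> td X = P \<Longrightarrow> I P \<cdot> X = X"
  by (hypsubst, (elim arrE, simp add: cls_eq_iff src_ob tgt_ob), (rule seq_id_left; simp add: tm_def))

lemma tape_id_right: "arr X \<Longrightarrow> tc X = P \<Longrightarrow> X \<cdot> I P = X"
  by (hypsubst, (elim arrE, simp add: cls_eq_iff src_ob tgt_ob), (rule seq_id_right; simp add: tm_def))

lemma tape_par_assoc: "arr X \<Longrightarrow> arr Y \<Longrightarrow> arr Z \<Longrightarrow> (X \<otimes> Y) \<otimes> Z = X \<otimes> (Y \<otimes> Z)"
  by ((elim arrE, simp add: cls_eq_iff), (rule par_assoc; simp))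

lemma tape_par_unit: "arr X \<Longrightarrow> I [] \<otimes> X = X" "arr X \<Longrightarrow> X \<otimes> I [] = X"
  by ((elim arrE, simp add: cls_eq_iff par_unit_left par_unit_right))+

lemma tape_interchange:
  "arr X \<Longrightarrow> arr X' \<Longrightarrow> arr Y \<Longrightarrow> arr Y' \<Longrightarrow> tc X = td Y \<Longrightarrow> tc X' = td Y' \<Longrightarrow>
   (X \<otimes> X') \<cdot> (Y \<otimes> Y') = (X \<cdot> Y) \<otimes> (X' \<cdot> Y')"
  by ((elim arrE, simp add: cls_eq_iff src_ob tgt_ob), (rule interchange; simp add: tm_def))

lemma tape_par_id: "P \<in> lists (Ob C) \<Longrightarrow> Q \<in> lists (Ob C) \<Longrightarrow> I P \<otimes> I Q = I (P @ Q)"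
  by (auto simp: cls_eq_iff intro!: par_id)

lemma tape_category: "Defs.category (tape_category C)"
proof
  fix X A B assume "X \<in> hom (tape_category C) A B"
  then show "Ident (tape_category C) A \<cdot> X = X" "X \<cdot> Ident (tape_category C) B = X"
    by (simp_all add: hom_def tape_id_left tape_id_right)
next
  fix X Y Z A B D E
  assume "X \<in> hom (tape_category C) A B" "Y \<in> hom (tape_category C) B D"
    "Z \<in> hom (tape_category C) D E"
  then show "X \<cdot> Y \<cdot> Z = X \<cdot> (Y \<cdot> Z)" by (simp add: hom_def tape_assoc)
qed (auto simp: hom_def)

lemma tape_swap_nat:
  "arr X \<Longrightarrow> arr Y \<Longrightarrow> tc X = Q \<Longrightarrow> tc Y = Q' \<Longrightarrow> (X \<otimes> Y) \<cdot> sw Q Q' = sw (td X) (td Y) \<cdot> (Y \<otimes> X)"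
  by (hypsubst, (elim arrE, simp add: cls_eq_iff src_ob tgt_ob), (rule swap_nat; simp add: tm_def))

lemma tape_swap_unit: "P \<in> lists (Ob C) \<Longrightarrow> sw P [] = I P" "sw [] P = I P"
  by (auto simp: cls_eq_iff intro!: swap_unit)

lemma tape_merge:
  assumes "P \<in> lists (Ob C)"
  shows "(mg P \<otimes> I P) \<cdot> mg P = (I P \<otimes> mg P) \<cdot> mg P"
    and "(cb P \<otimes> I P) \<cdot> mg P = I P"
    and "sw P P \<cdot> mg P = mg P"
  using assms by (auto simp: cls_eq_iff intro!: merge_assoc merge_unit merge_comm)

text \<open>The presentation imposes the left unit law; inserting the symmetry, which merging
  absorbs, exchanges the two sides.\<close>

lemma tape_merge_unit_right: "P \<in> lists (Ob C) \<Longrightarrow> (I P \<otimes> cb P) \<cdot> mg P = I P"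
proof -
  assume P: "P \<in> lists (Ob C)"
  then have "(I P \<otimes> cb P) \<cdot> mg P = (I P \<otimes> cb P) \<cdot> sw P P \<cdot> mg P"
    by (subst tape_assoc) (simp_all only: tape_merge, auto)
  also have "(I P \<otimes> cb P) \<cdot> sw P P = cb P \<otimes> I P"
    using P by (subst tape_swap_nat) (auto simp: tape_swap_unit tape_id_left simp del: par_cls cmp_cls)
  finally show ?thesis using P by (simp only: tape_merge)
qed

lemma tape_split:
  assumes "P \<in> lists (Ob C)" "0 < p" "p < 1"
  shows "0 < q \<Longrightarrow> q < 1 \<Longrightarrow> sp p P \<cdot> (sp q P \<otimes> I P) =
      sp (p * q) P \<cdot> (I P \<otimes> sp (p * (1 - q) / (1 - p * q)) P)"
    and "sp p P \<cdot> mg P = I P"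
    and "sp p P \<cdot> sw P P = sp (1 - p) P"
proof -
  show "sp p P \<cdot> (sp q P \<otimes> I P) = sp (p * q) P \<cdot> (I P \<otimes> sp (p * (1 - q) / (1 - p * q)) P)"
    if q: "0 < q" "q < 1"
  proof -
    note split_weight_bounds[OF assms(2,3) q]
    then show ?thesis using assms q by (auto simp: cls_eq_iff intro!: split_assoc)
  qed
qed (use assms in \<open>auto intro!: cls_eqI split_merge split_comm\<close>)

lemma tape_nat:
  assumes "arr X" "td X = P" "tc X = Q"
  shows tape_cobang_nat: "cb P \<cdot> X = cb Q"
    and tape_merge_nat: "mg P \<cdot> X = (X \<otimes> X) \<cdot> mg Q"
    and tape_bang_nat: "X \<cdot> br Q = br P"
    and tape_split_nat: "0 < p \<Longrightarrow> p < 1 \<Longrightarrow> X \<cdot> sp p Q = sp p P \<cdot> (X \<otimes> X)"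
proof -
  obtain t where t: "typed C t" "X = cls C t" using assms(1) by (rule arrE)
  with assms have st: "src C t = P" "tgt C t = Q" by auto
  have P: "P \<in> lists (Ob C)" "Q \<in> lists (Ob C)" using t(1) st src_ob tgt_ob by auto
  have tm: "t \<in> tm C P Q" using t st by (simp add: tm_def)
  show "cb P \<cdot> X = cb Q" "mg P \<cdot> X = (X \<otimes> X) \<cdot> mg Q" "X \<cdot> br Q = br P"
    using t st P by (simp_all add: cls_eq_iff cobang_nat[OF tm] merge_nat[OF tm] bang_nat[OF tm])
  show "X \<cdot> sp p Q = sp p P \<cdot> (X \<otimes> X)" if "0 < p" "p < 1"
    using t st P that by (simp add: cls_eq_iff split_nat[OF that tm])
qed

section \<open>The pca structure on the hom-sets\<close>

lemma tape_plus_eq: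
  "td X = P \<Longrightarrow> tc X = Q \<Longrightarrow> tape_plus C p X Y = sp p P \<cdot> (X \<otimes> Y) \<cdot> mg Q"
  by (simp add: tape_plus_def)

lemma tape_plus_simps [simp]:
  assumes "arr X" "arr Y" "td Y = td X" "tc Y = tc X" "0 < p" "p < 1"
  shows "arr (tape_plus C p X Y)" "td (tape_plus C p X Y) = td X" "tc (tape_plus C p X Y) = tc X"
  using assms by (simp_all add: tape_plus_def)

text \<open>As in \<open>tape_plus_comm\<close>, a co-pca law acts before the parallel arrows and
  the matching monoid law after them.\<close>

lemma tape_plus_assoc:
  assumes X: "arr X" "arr Y" "arr Z" "td X = P" "td Y = P" "td Z = P" "tc X = Q" "tc Y = Q" "tc Z = Q"
    and p: "0 < p" "p < 1" "0 < q" "q < 1"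
  shows "tape_plus C p (tape_plus C q X Y) Z =
    tape_plus C (p * q) X (tape_plus C (p * (1 - q) / (1 - p * q)) Y Z)"
proof -
  \<comment> \<open>With these rules active, composites of classes collapse into the class of one
    term, and the laws for \<open>\<cdot>\<close> and \<open>\<otimes>\<close> no longer
    match.\<close>
  note [simp del] = cmp_cls par_cls
  let ?r = "p * (1 - q) / (1 - p * q)"
  note b = split_weight_bounds[OF p]
  have P: "P \<in> lists (Ob C)" "Q \<in> lists (Ob C)" using td_ob[OF X(1)] tc_ob[OF X(1)] X by simp_all
  have "tape_plus C q X Y \<otimes> Z = (sp q P \<otimes> I P) \<cdot> ((X \<otimes> Y) \<otimes> Z) \<cdot> (mg Q \<otimes> I Q)"
    using X P p by (simp add: tape_plus_eq tape_interchange tape_id_left tape_id_right)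
  then have "tape_plus C p (tape_plus C q X Y) Z =
      sp p P \<cdot> ((sp q P \<otimes> I P) \<cdot> ((X \<otimes> Y) \<otimes> Z) \<cdot> (mg Q \<otimes> I Q)) \<cdot> mg Q"
    using X p by (subst tape_plus_eq[of _ P Q]) auto
  also have "\<dots> = (sp p P \<cdot> (sp q P \<otimes> I P)) \<cdot> ((X \<otimes> Y) \<otimes> Z) \<cdot> ((mg Q \<otimes> I Q) \<cdot> mg Q)"
    using X P p by (simp add: tape_assoc)
  also have "\<dots> = (sp (p * q) P \<cdot> (I P \<otimes> sp ?r P)) \<cdot> (X \<otimes> (Y \<otimes> Z)) \<cdot> ((I Q \<otimes> mg Q) \<cdot> mg Q)"
    using X P p by (simp only: tape_split tape_merge tape_par_assoc)
  also have "\<dots> = sp (p * q) P \<cdot> ((I P \<otimes> sp ?r P) \<cdot> (X \<otimes> (Y \<otimes> Z)) \<cdot> (I Q \<otimes> mg Q)) \<cdot> mg Q"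
    using X P p b by (simp add: tape_assoc)
  also have "(I P \<otimes> sp ?r P) \<cdot> (X \<otimes> (Y \<otimes> Z)) \<cdot> (I Q \<otimes> mg Q) = X \<otimes> tape_plus C ?r Y Z"
    using X P p b by (simp add: tape_plus_eq tape_interchange tape_id_left tape_id_right)
  finally show ?thesis using X by (simp add: tape_plus_eq)
qed

lemma tape_plus_comm:
  assumes X: "arr X" "arr Y" "td X = P" "td Y = P" "tc X = Q" "tc Y = Q"
    and p: "0 < p" "p < 1"
  shows "tape_plus C p X Y = tape_plus C (1 - p) Y X"
proof -
  note [simp del] = cmp_cls par_cls
  have P: "P \<in> lists (Ob C)" "Q \<in> lists (Ob C)" using td_ob[OF X(1)] tc_ob[OF X(1)] X by simp_all
  have "tape_plus C p X Y = sp p P \<cdot> ((X \<otimes> Y) \<cdot> sw Q Q) \<cdot> mg Q"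
    using X P p by (simp add: tape_plus_eq tape_assoc tape_merge)
  also have "(X \<otimes> Y) \<cdot> sw Q Q = sw P P \<cdot> (Y \<otimes> X)"
    using X by (simp add: tape_swap_nat)
  also have "sp p P \<cdot> (sw P P \<cdot> (Y \<otimes> X)) \<cdot> mg Q = (sp p P \<cdot> sw P P) \<cdot> (Y \<otimes> X) \<cdot> mg Q"
    using X P p by (simp add: tape_assoc)
  finally show ?thesis using X P p by (simp add: tape_plus_eq tape_split)
qed

text \<open>Naturality of merging moves \<open>X\<close> to the outside and leaves a splitting
  followed at once by a merging.\<close>

lemma tape_plus_idem:
  assumes X: "arr X" "0 < p" "p < 1"
  shows "tape_plus C p X X = X"
proof -
  note [simp del] = cmp_cls par_cls
  have "tape_plus C p X X = sp p (td X) \<cdot> mg (td X) \<cdot> X"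
    using X tape_merge_nat[OF X(1)] by (simp add: tape_plus_eq tape_assoc)
  then show ?thesis using X by (simp add: tape_split tape_id_left)
qed

text \<open>This side of distributivity is naturality of splitting; \<open>tape_plus_cmp\<close> is
  naturality of merging.\<close>

lemma cmp_tape_plus:
  assumes X: "arr X" "arr Y" "arr Z" "tc X = td Y" "td Z = td Y" "tc Z = tc Y"
    and p: "0 < p" "p < 1"
  shows "X \<cdot> tape_plus C p Y Z = tape_plus C p (X \<cdot> Y) (X \<cdot> Z)"
proof -
  note [simp del] = cmp_cls par_cls
  have "X \<cdot> tape_plus C p Y Z = (X \<cdot> sp p (td Y)) \<cdot> (Y \<otimes> Z) \<cdot> mg (tc Y)"
    using X p by (simp add: tape_plus_eq tape_assoc)
  also have "X \<cdot> sp p (td Y) = sp p (td X) \<cdot> (X \<otimes> X)"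
    using X p by (simp add: tape_split_nat)
  also have "\<dots> \<cdot> (Y \<otimes> Z) = sp p (td X) \<cdot> ((X \<cdot> Y) \<otimes> (X \<cdot> Z))"
    using X p by (simp add: tape_assoc tape_interchange)
  finally show ?thesis using X by (simp add: tape_plus_eq)
qed

lemma tape_plus_cmp:
  assumes X: "arr X" "arr Y" "arr Z" "td Y = td X" "tc Y = tc X" "tc X = td Z"
    and p: "0 < p" "p < 1"
  shows "tape_plus C p X Y \<cdot> Z = tape_plus C p (X \<cdot> Z) (Y \<cdot> Z)"
proof -
  note [simp del] = cmp_cls par_cls
  have "tape_plus C p X Y \<cdot> Z = sp p (td X) \<cdot> (X \<otimes> Y) \<cdot> (mg (tc X) \<cdot> Z)"
    using X p by (simp add: tape_plus_eq tape_assoc)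
  also have "mg (tc X) \<cdot> Z = (Z \<otimes> Z) \<cdot> mg (tc Z)"
    using X by (simp add: tape_merge_nat)
  also have "sp p (td X) \<cdot> (X \<otimes> Y) \<cdot> \<dots> = sp p (td X) \<cdot> ((X \<otimes> Y) \<cdot> (Z \<otimes> Z)) \<cdot> mg (tc Z)"
    using X p by (simp add: tape_assoc)
  also have "(X \<otimes> Y) \<cdot> (Z \<otimes> Z) = (X \<cdot> Z) \<otimes> (Y \<cdot> Z)"
    using X p by (simp add: tape_interchange)
  finally show ?thesis using X by (simp add: tape_plus_eq)
qed

lemma tape_star_simps [simp]:
  assumes "P \<in> lists (Ob C)" "Q \<in> lists (Ob C)"
  shows "arr (tape_star C P Q)" "td (tape_star C P Q) = P" "tc (tape_star C P Q) = Q"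
  using assms by (simp_all add: tape_star_def)

lemma cmp_tape_star: "arr X \<Longrightarrow> tc X = Q \<Longrightarrow> R \<in> lists (Ob C) \<Longrightarrow> X \<cdot> tape_star C Q R = tape_star C (td X) R"
  unfolding tape_star_def
  by (subst tape_assoc[symmetric]) (auto simp: tape_bang_nat simp del: cmp_cls)

lemma tape_star_cmp: "arr X \<Longrightarrow> td X = Q \<Longrightarrow> R \<in> lists (Ob C) \<Longrightarrow> tape_star C R Q \<cdot> X = tape_star C R (tc X)"
  unfolding tape_star_def
  by (subst tape_assoc) (auto simp: tape_cobang_nat simp del: cmp_cls)

lemma tape_pca_enriched:
  "pca_enriched_category (tape_category C) (tape_star C) (tape_plus C)"
proof (intro pca_enriched_category.intro pca_enriched_category_axioms.intro)
  show "Defs.category (tape_category C)" by (rule tape_category)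
next
  fix A B assume AB: "A \<in> Ob (tape_category C)" "B \<in> Ob (tape_category C)"
  show "pca (hom (tape_category C) A B) (tape_star C A B) (tape_plus C)"
  proof
    fix p q :: real and X Y Z assume "0 < p" "p < 1" "0 < q" "q < 1"
      "X \<in> hom (tape_category C) A B" "Y \<in> hom (tape_category C) A B"
      "Z \<in> hom (tape_category C) A B"
    then show "tape_plus C p (tape_plus C q X Y) Z =
        tape_plus C (p * q) X (tape_plus C (p * (1 - q) / (1 - p * q)) Y Z)"
      by (intro tape_plus_assoc[of _ _ _ A B]) (simp_all add: hom_def)
  next
    fix p :: real and X Y assume "0 < p" "p < 1"
      "X \<in> hom (tape_category C) A B" "Y \<in> hom (tape_category C) A B"
    then show "tape_plus C p X Y = tape_plus C (1 - p) Y X"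
      by (intro tape_plus_comm[of _ _ A B]) (simp_all add: hom_def)
  qed (use AB in \<open>simp_all add: hom_def tape_plus_idem\<close>)
qed (simp_all add: hom_def cmp_tape_plus tape_plus_cmp cmp_tape_star tape_star_cmp)

end

section \<open>Arrows as convex combinations of generators\<close>

lemma nth_in_lists: "P \<in> lists A \<Longrightarrow> i < length P \<Longrightarrow> P ! i \<in> A"
  by (simp add: in_lists_conv_set)

text \<open>The coproduct injection of the \<open>i\<close>-th letter, as a term; the value on the
  empty word is a placeholder.\<close>

primrec injw :: "'o list \<Rightarrow> nat \<Rightarrow> ('o, 'a) tape" where
  "injw [] i = IdZ"
| "injw (U # P) i = (case i of 0 \<Rightarrow> IdO U \<oplus> cobangw P | Suc j \<Rightarrow> Cobang U \<oplus> injw P j)"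

lemma typed_injw [simp]:
  "i < length P \<Longrightarrow> src C (injw P i) = [P ! i]" "i < length P \<Longrightarrow> tgt C (injw P i) = P"
  "i < length P \<Longrightarrow> typed C (injw P i) \<longleftrightarrow> P \<in> lists (Ob C)"
  by (induction P arbitrary: i) (auto split: nat.split)

lemma sem_injw [simp]:
  "i < length P \<Longrightarrow> length xs = length P \<Longrightarrow> sem C (injw P i) xs = [xs ! i]"
proof (induction P arbitrary: i xs)
  case (Cons U P)
  then show ?case by (cases i) (auto simp: length_Suc_conv sem_par_Cons)
qed simp

text \<open>Independent of the chosen representative on valuations, by \<open>teq_sem\<close>;
  elsewhere it may depend on it.\<close>

definition tape_sem :: "('o, 'a, 'm) category_scheme \<Rightarrow> ('o, 'a) tape set \<Rightarrow>
    (('a \<Rightarrow> real) \<Rightarrow> real) list \<Rightarrow> (('a \<Rightarrow> real) \<Rightarrow> real) list" where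
  "tape_sem C X = sem C (rep X)"

context category
begin

section \<open>Injections and the restriction of arrows to letters\<close>

abbreviation inj where "inj P i \<equiv> cls C (injw P i)"

text \<open>The laws speak of words, and on a one-letter word the structural term is the generator
  padded with units. This lemma and the next three bring the generators within reach of the
  laws.\<close>

lemma cls_singleton:
  assumes "U \<in> Ob C"
  shows cls_IdO: "cls C (IdO U) = I [U]" and cls_Bang: "cls C (Bang U) = br [U]"
    and cls_Cobang: "cls C (Cobang U) = cb [U]"
  using assms by (simp_all add: cls_eq_iff teq.sym[OF par_unit_right])

lemma cls_Merge: assumes "U \<in> Ob C" shows "cls C (Merge U) = mg [U]"
proof -
  note [simp del] = cmp_cls par_cls
  have "mg [U] = (cls C (IdO U) \<otimes> I [U] \<otimes> I []) \<cdot> (cls C (Merge U) \<otimes> I [])"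
    using assms by (simp add: par_cls cmp_cls)
  also have "\<dots> = I [U, U] \<cdot> cls C (Merge U)"
    using assms by (simp add: cls_IdO tape_par_id tape_par_unit del: idw.simps)
  finally show ?thesis using assms by (simp add: tape_id_left del: idw.simps)
qed

lemma cls_Split: assumes "U \<in> Ob C" "0 < p" "p < 1" shows "cls C (Split p U) = sp p [U]"
proof -
  note [simp del] = cmp_cls par_cls
  have "sp p [U] = (cls C (Split p U) \<otimes> I []) \<cdot> (cls C (IdO U) \<otimes> sw [U] [] \<otimes> I [])"
    using assms by (simp add: par_cls cmp_cls)
  also have "\<dots> = cls C (Split p U) \<cdot> I [U, U]"
    using assms by (simp add: cls_IdO tape_par_id tape_par_unit tape_swap_unit del: idw.simps swapw.simps)
  finally show ?thesis using assms by (simp add: tape_id_right del: idw.simps)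
qed

lemma cls_Swap: assumes "U \<in> Ob C" "V \<in> Ob C" shows "cls C (Swap U V) = sw [U] [V]"
proof -
  note [simp del] = cmp_cls par_cls
  have "sw [U] [V] = (cls C (IdO U) \<otimes> I [V]) \<cdot>
      (((cls C (Swap U V) \<otimes> I []) \<cdot> (cls C (IdO V) \<otimes> cls C (IdO U))) \<otimes> I [])"
    using assms by (simp add: par_cls cmp_cls)
  also have "\<dots> = I [U, V] \<cdot> (cls C (Swap U V) \<cdot> I [V, U])"
    using assms by (simp add: cls_IdO tape_par_id tape_par_unit del: idw.simps)
  finally show ?thesis using assms by (simp add: tape_id_right tape_id_left del: idw.simps)
qed

lemma cb_append: "P \<in> lists (Ob C) \<Longrightarrow> Q \<in> lists (Ob C) \<Longrightarrow> cb (P @ Q) = cb P \<otimes> cb Q"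
proof (induction P)
  case Nil
  then show ?case using tape_par_unit(1)[of "cb Q"] by simp
next
  case (Cons U P)
  have "cb ((U # P) @ Q) = cls C (Cobang U) \<otimes> cb (P @ Q)" using Cons.prems by simp
  also have "\<dots> = (cls C (Cobang U) \<otimes> cb P) \<otimes> cb Q"
    using Cons by (simp add: tape_par_assoc del: par_cls)
  finally show ?case using Cons by simp
qed

lemma cb_Cons: "U \<in> Ob C \<Longrightarrow> P \<in> lists (Ob C) \<Longrightarrow> cb (U # P) = cb [U] \<otimes> cb P"
  using cb_append[of "[U]" P] by simp

lemma inj_Cons:
  assumes "U \<in> Ob C" "P \<in> lists (Ob C)"
  shows "inj (U # P) 0 = I [U] \<otimes> cb P"
    and "i < length P \<Longrightarrow> inj (U # P) (Suc i) = cb [U] \<otimes> inj P i"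
  using assms cls_IdO[of U] cls_Cobang[of U] by (simp_all flip: par_cls)

lemma inj_append:
  assumes "P \<in> lists (Ob C)" "Q \<in> lists (Ob C)"
  shows "i < length P \<Longrightarrow> inj (P @ Q) i = inj P i \<otimes> cb Q"
    and "i < length Q \<Longrightarrow> inj (P @ Q) (length P + i) = cb P \<otimes> inj Q i"
proof -
  note [simp del] = cmp_cls par_cls injw.simps cobangw.simps idw.simps
  show "i < length P \<Longrightarrow> inj (P @ Q) i = inj P i \<otimes> cb Q" using assms
  proof (induction P arbitrary: i)
    case (Cons U P)
    then show ?case
      by (cases i) (simp_all add: inj_Cons cb_append tape_par_assoc)
  qed simp
  show "i < length Q \<Longrightarrow> inj (P @ Q) (length P + i) = cb P \<otimes> inj Q i" using assms
  proof (induction P)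
    case Nil
    have "cb [] = I []" by (simp add: idw.simps cobangw.simps)
    with Nil show ?case by (simp add: tape_par_unit)
  next
    case (Cons U P)
    then show ?case by (simp add: inj_Cons cb_Cons[of U P] tape_par_assoc)
  qed
qed

text \<open>The copairing of the two injections is the identity: once the middle swap has passed the
  two units, each block meets its own unit law.\<close>

lemma inj_pair_merge:
  assumes "U \<in> Ob C" "P \<in> lists (Ob C)"
  shows "((I [U] \<otimes> cb P) \<otimes> (cb [U] \<otimes> I P)) \<cdot> mg (U # P) = I (U # P)"
proof -
  note [simp del] = cmp_cls par_cls idw.simps cobangw.simps
  have mg: "mg (U # P) = (I [U] \<otimes> sw P [U] \<otimes> I P) \<cdot> (mg [U] \<otimes> mg P)"
    using assms cls_Merge[of U] cls_IdO[of U]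
    by (simp add: par_cls[symmetric] cmp_cls[symmetric] del: mergew.simps(2))
       (simp add: par_cls[symmetric] cmp_cls[symmetric])
  have "((I [U] \<otimes> cb P) \<otimes> (cb [U] \<otimes> I P)) \<cdot> (I [U] \<otimes> sw P [U] \<otimes> I P)
      = (I [U] \<otimes> (cb P \<otimes> cb [U]) \<otimes> I P) \<cdot> (I [U] \<otimes> sw P [U] \<otimes> I P)"
    using assms by (simp add: tape_par_assoc)
  also have "\<dots> = I [U] \<otimes> ((cb P \<otimes> cb [U]) \<cdot> sw P [U]) \<otimes> I P"
    using assms by (simp add: tape_interchange tape_id_left)
  also have "(cb P \<otimes> cb [U]) \<cdot> sw P [U] = cb [U] \<otimes> cb P"
    using assms by (simp add: tape_swap_nat tape_swap_unit tape_id_left del: swapw.simps)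
  also have "I [U] \<otimes> (cb [U] \<otimes> cb P) \<otimes> I P = (I [U] \<otimes> cb [U]) \<otimes> (cb P \<otimes> I P)"
    using assms by (simp add: tape_par_assoc)
  finally have "((I [U] \<otimes> cb P) \<otimes> (cb [U] \<otimes> I P)) \<cdot> mg (U # P) =
      ((I [U] \<otimes> cb [U]) \<otimes> (cb P \<otimes> I P)) \<cdot> (mg [U] \<otimes> mg P)"
    unfolding mg using assms by (subst tape_assoc[symmetric]) simp_all
  also have "\<dots> = I [U] \<otimes> I P"
    using assms by (simp add: tape_interchange tape_merge tape_merge_unit_right del: mergew.simps)
  finally show ?thesis using assms by (simp add: tape_par_id)
qed

text \<open>By naturality of merging and \<open>inj_pair_merge\<close>, an arrow out of
  \<open>U # P\<close> is the merge of its restrictions to \<open>U\<close> and to \<open>P\<close>.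
  Out of the empty word there is only \<open>cobangw\<close>.\<close>

lemma eq_if_inj_eq:
  assumes "arr X" "arr Y" "td X = P" "td Y = P" "tc X = Q" "tc Y = Q"
    and "\<And>i. i < length P \<Longrightarrow> inj P i \<cdot> X = inj P i \<cdot> Y"
  shows "X = Y"
  using assms
proof (induction P arbitrary: X Y)
  case Nil
  note [simp del] = cmp_cls par_cls
  have "Z = cb Q" if "arr Z" "td Z = []" "tc Z = Q" for Z
    using tape_id_left[OF that(1,2)] tape_cobang_nat[OF that] by simp
  with Nil show ?case by metis
next
  case (Cons U P)
  note [simp del] = cmp_cls par_cls injw.simps cobangw.simps idw.simps mergew.simps
  from Cons have ob: "U \<in> Ob C" "P \<in> lists (Ob C)" using td_ob[of X] by auto
  let ?i = "I [U] \<otimes> cb P" and ?j = "cb [U] \<otimes> I P"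
  have decomp: "((?i \<cdot> Z) \<otimes> (?j \<cdot> Z)) \<cdot> mg Q = Z"
    if Z: "arr Z" "td Z = U # P" "tc Z = Q" for Z
  proof -
    have Q: "Q \<in> lists (Ob C)" using Z tc_ob[of Z] by simp
    have "((?i \<cdot> Z) \<otimes> (?j \<cdot> Z)) \<cdot> mg Q = (?i \<otimes> ?j) \<cdot> ((Z \<otimes> Z) \<cdot> mg Q)"
      using Z ob Q by (simp add: tape_assoc flip: tape_interchange)
    also have "(Z \<otimes> Z) \<cdot> mg Q = mg (U # P) \<cdot> Z"
      using Z ob Q by (simp add: tape_merge_nat)
    also have "(?i \<otimes> ?j) \<cdot> \<dots> = (?i \<otimes> ?j) \<cdot> mg (U # P) \<cdot> Z"
      using Z ob Q by (simp add: tape_assoc)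
    finally show ?thesis using Z ob by (simp add: inj_pair_merge tape_id_left)
  qed
  have "?i \<cdot> X = ?i \<cdot> Y" using Cons.prems(7)[of 0] ob by (simp add: inj_Cons)
  moreover have "?j \<cdot> X = ?j \<cdot> Y"
  proof (rule Cons.IH)
    fix i assume i: "i < length P"
    have "inj P i \<cdot> (?j \<cdot> Z) = inj (U # P) (Suc i) \<cdot> Z" if "arr Z" "td Z = U # P" for Z
    proof -
      have "inj P i \<cdot> ?j = (I [] \<otimes> inj P i) \<cdot> ?j" using i ob by (simp add: tape_par_unit)
      also have "\<dots> = cb [U] \<otimes> inj P i"
        using i ob by (simp add: tape_interchange tape_id_left tape_id_right)
      finally have *: "inj P i \<cdot> ?j = inj (U # P) (Suc i)" using i ob by (simp add: inj_Cons)
      have "inj P i \<cdot> (?j \<cdot> Z) = inj P i \<cdot> ?j \<cdot> Z" using that i ob by (simp add: tape_assoc)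
      then show ?thesis using * by simp
    qed
    then show "inj P i \<cdot> (?j \<cdot> X) = inj P i \<cdot> (?j \<cdot> Y)"
      using Cons.prems i by simp
  qed (use Cons.prems ob in simp_all)
  ultimately show ?case using decomp[of X] decomp[of Y] Cons.prems(1-6) by metis
qed

section \<open>Spanning by generators\<close>

definition gens :: "'o \<Rightarrow> 'o list \<Rightarrow> (nat \<times> 'a) set" where
  "gens U Q = {(j, c). j < length Q \<and> c \<in> hom C U (Q ! j)}"

text \<open>Generators are indexed by pairs: that distinct pairs name distinct arrows emerges only
  later, through \<open>weight\<close>.\<close>

definition gen_arr :: "'o list \<Rightarrow> nat \<times> 'a \<Rightarrow> ('o, 'a) tape set" where
  "gen_arr Q = (\<lambda>(j, c). cls C (Gen c) \<cdot> inj Q j)"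

abbreviation span where
  "span U Q \<equiv> cvx_span (tape_star C [U] Q) (tape_plus C) (gen_arr Q ` gens U Q)"

lemma gen_arr_hom:
  "U \<in> Ob C \<Longrightarrow> Q \<in> lists (Ob C) \<Longrightarrow> k \<in> gens U Q \<Longrightarrow> gen_arr Q k \<in> hom (tape_category C) [U] Q"
  by (auto simp: gens_def gen_arr_def hom_def)

lemma tape_hom_pca:
  "P \<in> lists (Ob C) \<Longrightarrow> Q \<in> lists (Ob C) \<Longrightarrow>
   pca (hom (tape_category C) P Q) (tape_star C P Q) (tape_plus C)"
  using pca_enriched_category.hom_pca[OF tape_pca_enriched] by simp

lemma span_hom:
  assumes "U \<in> Ob C" "Q \<in> lists (Ob C)" "X \<in> span U Q"
  shows "arr X" "td X = [U]" "tc X = Q"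
proof -
  have "span U Q \<subseteq> hom (tape_category C) [U] Q"
    using assms gen_arr_hom by (intro pca.cvx_span_subset tape_hom_pca) auto
  then show "arr X" "td X = [U]" "tc X = Q" using assms(3) by (auto simp: hom_def)
qed

text \<open>Left composition with \<open>c\<close> turns the generator \<open>(j, d)\<close> into
  \<open>(j, c \<odot> d)\<close> and respects sums and \<open>star\<close>.\<close>

lemma gen_cmp_span:
  assumes "X \<in> span V Q" "c \<in> hom C U V" "Q \<in> lists (Ob C)"
  shows "cls C (Gen c) \<cdot> X \<in> span U Q"
  using assms(1)
proof (induction rule: cvx_span.induct)
  note [simp del] = cmp_cls par_cls
  have c: "c \<in> Ar C" "Dom C c = U" "Cod C c = V" "U \<in> Ob C" "V \<in> Ob C"
    using assms dom_ob cod_ob by (auto simp: hom_def)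
  {
    case star
    then show ?case using c assms by (simp add: cmp_tape_star cvx_span.star)
  next
    case (gen X)
    then obtain j d where d: "X = cls C (Gen d) \<cdot> inj Q j" "j < length Q" "d \<in> hom C V (Q ! j)"
      by (auto simp: gens_def gen_arr_def)
    then have d': "d \<in> Ar C" "Dom C d = V" "Cod C d = Q ! j" by (auto simp: hom_def)
    have "cls C (Gen c) \<cdot> X = cls C (Gen c) \<cdot> cls C (Gen d) \<cdot> inj Q j"
      using c d d' assms by (simp add: tape_assoc)
    also have "cls C (Gen c) \<cdot> cls C (Gen d) = cls C (Gen (c \<odot> d))"
      using c d' gen_cmp[OF assms(2) d(3)] by (simp add: cmp_cls cls_eq_iff teq.sym)
    finally have "cls C (Gen c) \<cdot> X = gen_arr Q (j, c \<odot> d)" by (simp add: gen_arr_def)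
    moreover have "(j, c \<odot> d) \<in> gens U Q"
      using d assms cmp_hom by (auto simp: gens_def)
    ultimately show ?case by (auto intro!: cvx_span.gen)
  next
    case (plus p X Y)
    then have "cls C (Gen c) \<cdot> tape_plus C p X Y =
        tape_plus C p (cls C (Gen c) \<cdot> X) (cls C (Gen c) \<cdot> Y)"
      using c span_hom[OF c(5) assms(3) plus(3)] span_hom[OF c(5) assms(3) plus(4)]
      by (intro cmp_tape_plus) simp_all
    then show ?case using plus by (auto intro: cvx_span.plus)
  }
qed

text \<open>Matrix multiplication: a generator \<open>(j, d)\<close> of \<open>X\<close> is expanded
  along the \<open>j\<close>-th row of \<open>T\<close>, its restriction to the letter
  \<open>Q ! j\<close>.\<close>

lemma span_cmp:
  assumes "X \<in> span U Q" "U \<in> Ob C" "arr T" "td T = Q" "tc T = R"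
    and T: "\<And>j. j < length Q \<Longrightarrow> inj Q j \<cdot> T \<in> span (Q ! j) R"
  shows "X \<cdot> T \<in> span U R"
  using assms(1)
proof (induction rule: cvx_span.induct)
  note [simp del] = cmp_cls par_cls
  have ob: "Q \<in> lists (Ob C)" "R \<in> lists (Ob C)" using assms td_ob[of T] tc_ob[of T] by simp_all
  {
    case star
    then show ?case using assms by (simp add: tape_star_cmp cvx_span.star)
  next
    case (gen X)
    then obtain j d where d: "X = cls C (Gen d) \<cdot> inj Q j" "j < length Q" "d \<in> hom C U (Q ! j)"
      by (auto simp: gens_def gen_arr_def)
    then have "X \<cdot> T = cls C (Gen d) \<cdot> (inj Q j \<cdot> T)"
      using assms ob by (simp add: hom_def tape_assoc)
    then show ?case using gen_cmp_span[OF T d(3)] d ob by simp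
  next
    case (plus p X Y)
    then have "tape_plus C p X Y \<cdot> T = tape_plus C p (X \<cdot> T) (Y \<cdot> T)"
      using assms span_hom[OF assms(2) ob(1) plus(3)] span_hom[OF assms(2) ob(1) plus(4)]
      by (intro tape_plus_cmp) simp_all
    then show ?case using plus by (auto intro: cvx_span.plus)
  }
qed

lemma cls_Gen_Ident: "U \<in> Ob C \<Longrightarrow> cls C (Gen (Ident C U)) = I [U]"
  using ident_hom[of U] gen_id[of U C] cls_IdO[of U] cls_eqI by metis

lemma inj_in_span:
  assumes "j < length Q" "Q \<in> lists (Ob C)"
  shows "inj Q j \<in> span (Q ! j) Q"
proof -
  note [simp del] = cmp_cls par_cls
  have U: "Q ! j \<in> Ob C" using assms by (simp add: nth_in_lists)
  then have "gen_arr Q (j, Ident C (Q ! j)) = inj Q j"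
    using assms by (simp add: gen_arr_def cls_Gen_Ident tape_id_left del: idw.simps)
  moreover have "(j, Ident C (Q ! j)) \<in> gens (Q ! j) Q"
    using assms U ident_hom by (simp add: gens_def)
  ultimately show ?thesis by (metis cvx_span.gen image_eqI)
qed

text \<open>Each tape is a matrix whose rows are convex combinations: splitting contributes sums,
  discarding contributes \<open>star\<close>, merging and swapping redirect injections, and
  sequential composition is \<open>span_cmp\<close>.\<close>

lemma inj_cmp_cls_in_span:
  "typed C t \<Longrightarrow> i < length (src C t) \<Longrightarrow> inj (src C t) i \<cdot> cls C t \<in> span (src C t ! i) (tgt C t)"
proof (induction t arbitrary: i)
  note [simp del] = cmp_cls par_cls idw.simps bangw.simps cobangw.simps injw.simps
    swapw.simps splitw.simps mergew.simps
  have nil: "cb [] = I []" "br [] = I []" by (simp_all add: idw.simps cobangw.simps bangw.simps)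
  have inj1: "inj [U] 0 = I [U]" if "U \<in> Ob C" for U
    using that by (simp add: inj_Cons nil tape_par_unit)
  have inj2: "inj [U, V] 0 = I [U] \<otimes> cb [V]" "inj [U, V] (Suc 0) = cb [U] \<otimes> I [V]"
    if "U \<in> Ob C" "V \<in> Ob C" for U V
    using that by (simp_all add: inj_Cons nil tape_par_unit)
  {
    case (Split p U)
    then have p: "0 < p" "p < 1" "U \<in> Ob C" by auto
    \<comment> \<open>The sum of the two injections is the splitting followed by their copairing,
      and that copairing is the identity.\<close>
    have "tape_plus C p (inj [U, U] 0) (inj [U, U] (Suc 0)) =
        sp p [U] \<cdot> (((I [U] \<otimes> cb [U]) \<otimes> (cb [U] \<otimes> I [U])) \<cdot> mg [U, U])"
      using p by (simp add: tape_plus_eq inj2 tape_assoc)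
    also have "\<dots> = inj [U] 0 \<cdot> cls C (Split p U)"
      using p inj_pair_merge[of U "[U]"]
      by (simp add: tape_id_left tape_id_right inj1 cls_Split)
    finally have eq: "tape_plus C p (inj [U, U] 0) (inj [U, U] (Suc 0)) = inj [U] 0 \<cdot> cls C (Split p U)" .
    have "tape_plus C p (inj [U, U] 0) (inj [U, U] (Suc 0)) \<in> span U [U, U]"
      using p inj_in_span[of 0 "[U, U]"] inj_in_span[of "Suc 0" "[U, U]"]
      by (intro cvx_span.plus) simp_all
    then show ?case using Split by (simp add: eq)
  next
    case (Bang U)
    then have "inj [U] 0 \<cdot> cls C (Bang U) = tape_star C [U] []"
      by (simp add: inj1 tape_id_left tape_id_right nil cls_Bang tape_star_def)
    then show ?case using Bang cvx_span.star by simp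
  next
    case (Merge U)
    then have "inj [U, U] i \<cdot> cls C (Merge U) = inj [U] 0"
      by (auto simp: less_Suc_eq inj1 inj2 cls_Merge tape_merge tape_merge_unit_right)
    moreover have "[U, U] ! i = U" using Merge by (auto simp: less_Suc_eq)
    ultimately show ?case using Merge inj_in_span[of 0 "[U]"] by simp
  next
    case (Cobang U)
    then show ?case by simp
  next
    case (Swap U V)
    then have "inj [U, V] i \<cdot> cls C (Swap U V) = inj [V, U] (1 - i)"
      by (auto simp: less_Suc_eq inj2 cls_Swap tape_swap_nat tape_swap_unit tape_id_left)
    moreover have "[U, V] ! i = [V, U] ! (1 - i)" using Swap by (auto simp: less_Suc_eq)
    ultimately show ?case using Swap inj_in_span[of "1 - i" "[V, U]"] by simp
  next
    case (IdO U)
    then show ?case using inj_in_span[of 0 "[U]"] by (simp add: cls_IdO inj1 tape_id_left)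
  next
    case IdZ
    then show ?case by simp
  next
    case (Gen c)
    then have "inj [Dom C c] 0 \<cdot> cls C (Gen c) = cls C (Gen c) \<cdot> inj [Cod C c] 0"
      by (simp add: inj1 tape_id_left tape_id_right dom_ob cod_ob)
    moreover have "cls C (Gen c) \<cdot> inj [Cod C c] 0 \<in> span (Dom C c) [Cod C c]"
      using Gen cod_ob gen_cmp_span[of "inj [Cod C c] 0" "Cod C c" "[Cod C c]" c "Dom C c"]
        inj_in_span[of 0 "[Cod C c]"] by (simp add: hom_def)
    ultimately show ?case using Gen by simp
  next
    case (Seq s t)
    then have "inj (src C s) i \<cdot> cls C (s ;; t) = inj (src C s) i \<cdot> cls C s \<cdot> cls C t"
      by (simp add: tape_assoc src_ob cmp_cls[of s t, symmetric])
    moreover have "src C s ! i \<in> Ob C" using Seq nth_in_lists[OF src_ob[of s]] by simp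
    ultimately show ?case
      using Seq span_cmp[of "inj (src C s) i \<cdot> cls C s" "src C s ! i" "tgt C s" "cls C t" "tgt C t"]
      by simp
  next
    case (Par s t)
    let ?P = "src C s" and ?P' = "src C t" and ?Q = "tgt C s" and ?Q' = "tgt C t"
    have ty: "typed C s" "typed C t" using Par by auto
    note ob = src_ob[OF ty(1)] src_ob[OF ty(2)] tgt_ob[OF ty(1)] tgt_ob[OF ty(2)]
    have par: "cls C (s \<oplus> t) = cls C s \<otimes> cls C t" using ty by (simp add: par_cls)
    show ?case
    proof (cases "i < length ?P")
      case True
      \<comment> \<open>On a letter of the left factor, \<open>t\<close> survives only as
        \<open>cb ?Q'\<close>, by naturality of the cobang. Composing with \<open>?T\<close> then
        turns injections into \<open>?Q\<close> into injections into \<open>?Q @ ?Q'\<close>. The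
        other case mirrors this.\<close>
      let ?T = "I ?Q \<otimes> cb ?Q'"
      have U: "?P ! i \<in> Ob C" using True ob by (simp add: nth_in_lists)
      have "inj (?P @ ?P') i \<cdot> cls C (s \<oplus> t) = (inj ?P i \<cdot> cls C s) \<otimes> cb ?Q'"
        using True ob ty by (simp add: par inj_append tape_interchange tape_cobang_nat)
      also have "\<dots> = (inj ?P i \<cdot> cls C s) \<otimes> (I [] \<cdot> cb ?Q')"
        using True ob ty by (simp add: tape_id_left)
      also have "\<dots> = ((inj ?P i \<cdot> cls C s) \<otimes> I []) \<cdot> ?T"
        using True ob ty by (simp add: tape_interchange tape_id_right)
      also have "(inj ?P i \<cdot> cls C s) \<otimes> I [] = inj ?P i \<cdot> cls C s"
        using True ob ty by (simp add: tape_par_unit)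
      also have "\<dots> \<cdot> ?T \<in> span (?P ! i) (?Q @ ?Q')"
      proof (rule span_cmp[OF Par.IH(1)])
        fix j assume j: "j < length ?Q"
        have "inj ?Q j \<cdot> ?T = (inj ?Q j \<otimes> I []) \<cdot> ?T" using j ob by (simp add: tape_par_unit)
        also have "\<dots> = inj (?Q @ ?Q') j"
          using j ob by (simp add: tape_interchange tape_id_left tape_id_right inj_append)
        finally show "inj ?Q j \<cdot> ?T \<in> span (?Q ! j) (?Q @ ?Q')"
          using inj_in_span[of j "?Q @ ?Q'"] j ob by (simp add: nth_append)
      qed (use True ty U ob in simp_all)
      finally show ?thesis using True by (simp add: nth_append)
    next
      case False
      then obtain k where k: "i = length ?P + k" "k < length ?P'"
        using Par.prems by (metis add_diff_inverse_nat length_append nat_add_left_cancel_less src.simps(10))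
      let ?T = "cb ?Q \<otimes> I ?Q'"
      have U: "?P' ! k \<in> Ob C" using k ob by (simp add: nth_in_lists)
      have "inj (?P @ ?P') i \<cdot> cls C (s \<oplus> t) = cb ?Q \<otimes> (inj ?P' k \<cdot> cls C t)"
        using k ob ty by (simp add: par inj_append tape_interchange tape_cobang_nat)
      also have "\<dots> = (I [] \<cdot> cb ?Q) \<otimes> (inj ?P' k \<cdot> cls C t)"
        using k ob ty by (simp add: tape_id_left)
      also have "\<dots> = (I [] \<otimes> (inj ?P' k \<cdot> cls C t)) \<cdot> ?T"
        using k ob ty by (simp add: tape_interchange tape_id_right)
      also have "I [] \<otimes> (inj ?P' k \<cdot> cls C t) = inj ?P' k \<cdot> cls C t"
        using k ob ty by (simp add: tape_par_unit)
      also have "\<dots> \<cdot> ?T \<in> span (?P' ! k) (?Q @ ?Q')"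
      proof (rule span_cmp[OF Par.IH(2)])
        fix j assume j: "j < length ?Q'"
        have "inj ?Q' j \<cdot> ?T = (I [] \<otimes> inj ?Q' j) \<cdot> ?T" using j ob by (simp add: tape_par_unit)
        also have "\<dots> = inj (?Q @ ?Q') (length ?Q + j)"
          using j ob by (simp add: tape_interchange tape_id_left tape_id_right inj_append)
        finally show "inj ?Q' j \<cdot> ?T \<in> span (?Q' ! j) (?Q @ ?Q')"
          using inj_in_span[of "length ?Q + j" "?Q @ ?Q'"] j ob by (simp add: nth_append)
      qed (use k ty U ob in simp_all)
      finally show ?thesis using k by (simp add: nth_append)
    qed
  }
qed

end

section \<open>Faithfulness of the interpretation\<close>

context category
begin

section \<open>The interpretation on classes\<close>

lemma length_tape_sem [simp]: "arr X \<Longrightarrow> length (tape_sem C X xs) = length (td X)"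
  by (auto elim!: arrE simp: tape_sem_def)

lemma tape_sem_cls [simp]:
  "typed C t \<Longrightarrow> valuation C (tgt C t) xs \<Longrightarrow> tape_sem C (cls C t) xs = sem C t xs"
  unfolding tape_sem_def using teq_sem[OF teq_rep[of t]] by simp

lemma valuation_tape_sem [simp]:
  assumes "arr X" "tc X = Q" "valuation C Q xs"
  shows "valuation C (td X) (tape_sem C X xs)"
proof -
  obtain t where t: "typed C t" "X = cls C t" using assms(1) by (rule arrE)
  then show ?thesis using assms valuation_sem[of t xs] by simp
qed

lemma tape_sem_cmp [simp]:
  assumes "arr X" "arr Y" "tc X = td Y" "valuation C (tc Y) xs"
  shows "tape_sem C (X \<cdot> Y) xs = tape_sem C X (tape_sem C Y xs)"
proof -
  obtain s where s: "typed C s" "X = cls C s" using assms(1) by (rule arrE)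
  obtain t where t: "typed C t" "Y = cls C t" using assms(2) by (rule arrE)
  show ?thesis using s t assms valuation_sem[of t xs] by simp
qed

lemma tape_sem_par:
  assumes "arr X" "arr Y" "valuation C (tc X) xs" "valuation C (tc Y) ys"
  shows "tape_sem C (X \<otimes> Y) (xs @ ys) = tape_sem C X xs @ tape_sem C Y ys"
proof -
  obtain s where s: "typed C s" "X = cls C s" using assms(1) by (rule arrE)
  obtain t where t: "typed C t" "Y = cls C t" using assms(2) by (rule arrE)
  show ?thesis using s t assms by (simp add: list_all2_appendI list_all2_lengthD)
qed

lemma tape_sem_lincomb:
  assumes "arr X" "valuation C (tc X) xs" "valuation C (tc X) ys" "valuation C (tc X) (lincomb a b xs ys)"
  shows "tape_sem C X (lincomb a b xs ys) = lincomb a b (tape_sem C X xs) (tape_sem C X ys)"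
proof -
  obtain t where t: "typed C t" "X = cls C t" using assms(1) by (rule arrE)
  have "length xs = length (tgt C t)" "length ys = length (tgt C t)"
    using assms t by (auto dest: list_all2_lengthD)
  then show ?thesis using t assms by (simp add: sem_lincomb)
qed

lemma valuation_lincomb [simp]:
  "valuation C P xs \<Longrightarrow> valuation C P ys \<Longrightarrow> valuation C P (lincomb a b xs ys)"
  by (auto simp: list_all2_conv_all_nth intro: local_on_lincomb)

lemma tape_sem_zero:
  "arr X \<Longrightarrow> tc X = Q \<Longrightarrow> tape_sem C X (replicate (length Q) (\<lambda>_. 0)) = replicate (length (td X)) (\<lambda>_. 0)"
  by (auto elim!: arrE simp: sem_zero)

lemma tape_sem_star:
  assumes "P \<in> lists (Ob C)" "Q \<in> lists (Ob C)" "valuation C Q xs"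
  shows "tape_sem C (tape_star C P Q) xs = replicate (length P) (\<lambda>_. 0)"
  using assms by (simp add: tape_star_def)

lemma tape_sem_plus:
  assumes "arr X" "arr Y" "td Y = td X" "tc Y = tc X" "0 < p" "p < 1" "valuation C (tc X) xs"
  shows "tape_sem C (tape_plus C p X Y) xs = lincomb p (1 - p) (tape_sem C X xs) (tape_sem C Y xs)"
proof -
  note [simp del] = cmp_cls par_cls
  have "valuation C (tc X @ tc Y) (xs @ xs)" using assms by (simp add: list_all2_appendI)
  moreover have "valuation C (td X @ td X) (tape_sem C X xs @ tape_sem C Y xs)"
    using assms valuation_tape_sem[of X "tc X" xs] valuation_tape_sem[of Y "tc X" xs]
    by (simp add: list_all2_appendI)
  ultimately show ?thesis
    using assms by (simp add: tape_plus_eq tape_sem_par list_all2_lengthD)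
qed

text \<open>The universal elements of the regular representation, one for each place of
  \<open>Q\<close>.\<close>

definition unit_val :: "'o list \<Rightarrow> nat \<Rightarrow> (('a \<Rightarrow> real) \<Rightarrow> real) list" where
  "unit_val Q j = map (\<lambda>i \<phi>. if i = j then \<phi> (Ident C (Q ! i)) else 0) [0..<length Q]"

lemma unit_val [simp]:
  "length (unit_val Q j) = length Q"
  "i < length Q \<Longrightarrow> unit_val Q j ! i = (\<lambda>\<phi>. if i = j then \<phi> (Ident C (Q ! i)) else 0)"
  by (auto simp: unit_val_def fun_eq_iff)

lemma valuation_unit_val: "Q \<in> lists (Ob C) \<Longrightarrow> valuation C Q (unit_val Q j)"
  using ident_hom by (auto simp: list_all2_conv_all_nth local_on_def hom_def nth_in_lists)

text \<open>The coefficient of the generator \<open>(j, c)\<close> in an arrow, by evaluation at a Dirac functional.\<close>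

definition weight :: "'o list \<Rightarrow> nat \<times> 'a \<Rightarrow> ('o, 'a) tape set \<Rightarrow> real" where
  "weight Q = (\<lambda>(j, c) X. (tape_sem C X (unit_val Q j) ! 0) (\<lambda>e. if e = c then 1 else 0))"

lemma span_eqI:
  assumes U: "U \<in> Ob C" and Q: "Q \<in> lists (Ob C)" and "X \<in> span U Q" "Y \<in> span U Q"
    and eq: "\<And>xs. valuation C Q xs \<Longrightarrow> tape_sem C X xs = tape_sem C Y xs"
  shows "X = Y"
proof (rule pca.eq_if_weights_eq[where K = "gens U Q" and g = "gen_arr Q" and w = "weight Q"])
  have UQ: "[U] \<in> lists (Ob C)" using U by simp
  show "pca (hom (tape_category C) [U] Q) (tape_star C [U] Q) (tape_plus C)"
    using UQ Q by (rule tape_hom_pca)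
  show "gen_arr Q k \<in> hom (tape_category C) [U] Q" if "k \<in> gens U Q" for k
    using gen_arr_hom U Q that by simp
  note val = valuation_unit_val[OF Q]
  show "weight Q k (tape_star C [U] Q) = 0" for k
    using U Q val by (cases k) (simp add: weight_def tape_sem_star)
  show "weight Q k (tape_plus C p X Y) = p * weight Q k X + (1 - p) * weight Q k Y"
    if "0 < p" "p < 1" "X \<in> hom (tape_category C) [U] Q" "Y \<in> hom (tape_category C) [U] Q" for k p X Y
    using that val by (cases k) (simp add: weight_def hom_def tape_sem_plus)
  show "weight Q k (gen_arr Q l) = (if k = l then 1 else 0)"
    if kl: "k \<in> gens U Q" "l \<in> gens U Q" for k l
  proof -
    obtain j c where k: "k = (j, c)" "j < length Q" "c \<in> hom C U (Q ! j)"
      using kl by (auto simp: gens_def)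
    obtain i d where l: "l = (i, d)" "i < length Q" "d \<in> hom C U (Q ! i)"
      using kl by (auto simp: gens_def)
    \<comment> \<open>The injection selects place \<open>i\<close>, hence the zero for
      \<open>i \<noteq> j\<close>; at \<open>i = j\<close> evaluation at the identity becomes
      evaluation at \<open>d\<close>, which the indicator of \<open>c\<close> then tests.\<close>
    have "tape_sem C (gen_arr Q l) (unit_val Q j) =
        [\<lambda>\<phi>. if i = j then \<phi> (d \<odot> Ident C (Q ! i)) else 0]"
      using l Q val by (simp add: gen_arr_def hom_def)
    then show ?thesis using k l ident_right[OF l(3)] by (auto simp: weight_def)
  qed
  show "weight Q k X = weight Q k Y" for k
    using eq[OF val] by (cases k) (simp add: weight_def)
qed (use assms in simp_all)

text \<open>Faithfulness. With it, most later equations between tapes are checked as identities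
  between lists of functionals.\<close>

lemma tape_eqI:
  assumes X: "arr X" "td X = P" "tc X = Q" and Y: "arr Y" "td Y = P" "tc Y = Q"
    and eq: "\<And>xs. valuation C Q xs \<Longrightarrow> tape_sem C X xs = tape_sem C Y xs"
  shows "X = Y"
proof (rule eq_if_inj_eq[OF X(1) Y(1) X(2) Y(2) X(3) Y(3)])
  fix i assume i: "i < length P"
  have ob: "P \<in> lists (Ob C)" "Q \<in> lists (Ob C)" using X td_ob[of X] tc_ob[of X] by auto
  note [simp del] = cmp_cls
  have span: "inj P i \<cdot> Z \<in> span (P ! i) Q" if "arr Z" "td Z = P" "tc Z = Q" for Z
    using that i inj_cmp_cls_in_span by (auto elim!: arrE)
  show "inj P i \<cdot> X = inj P i \<cdot> Y"
  proof (rule span_eqI)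
    show "P ! i \<in> Ob C" using ob i by (simp add: nth_in_lists)
    show "tape_sem C (inj P i \<cdot> X) xs = tape_sem C (inj P i \<cdot> Y) xs" if "valuation C Q xs" for xs
      using that X Y i ob eq by simp
  qed (use ob span X Y in auto)
qed

section \<open>Extended sums, scalar multiples and the zero object\<close>

lemma tape_sem_ext_plus:
  assumes "X \<in> hom (tape_category C) P Q" "Y \<in> hom (tape_category C) P Q" "0 \<le> p" "p \<le> 1"
  shows "ext_plus (tape_plus C) p X Y \<in> hom (tape_category C) P Q"
    and "valuation C Q xs \<Longrightarrow>
      tape_sem C (ext_plus (tape_plus C) p X Y) xs = lincomb p (1 - p) (tape_sem C X xs) (tape_sem C Y xs)"
proof -
  show "ext_plus (tape_plus C) p X Y \<in> hom (tape_category C) P Q"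
    using assms by (auto simp: ext_plus_def hom_def)
  assume "valuation C Q xs"
  moreover have "lincomb 1 0 xs ys = xs" "lincomb 0 1 ys xs = xs" if "length xs = length ys" for xs ys :: "(('a \<Rightarrow> real) \<Rightarrow> real) list"
    using that by (auto intro: nth_equalityI)
  ultimately show "tape_sem C (ext_plus (tape_plus C) p X Y) xs =
      lincomb p (1 - p) (tape_sem C X xs) (tape_sem C Y xs)"
    using assms by (auto simp: ext_plus_def hom_def tape_sem_plus)
qed

definition scale :: "real \<Rightarrow> ('b \<Rightarrow> real) list \<Rightarrow> ('b \<Rightarrow> real) list" where
  "scale p xs = map (\<lambda>x \<phi>. p * x \<phi>) xs"

lemma tape_sem_scal:
  assumes "X \<in> hom (tape_category C) P Q" "0 \<le> p" "p \<le> 1"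
  shows "scal (tape_category C) (tape_star C) (tape_plus C) p X \<in> hom (tape_category C) P Q"
    and "valuation C Q xs \<Longrightarrow>
      tape_sem C (scal (tape_category C) (tape_star C) (tape_plus C) p X) xs = scale p (tape_sem C X xs)"
proof -
  have ob: "P \<in> lists (Ob C)" "Q \<in> lists (Ob C)"
    using assms(1) td_ob[of X] tc_ob[of X] by (auto simp: hom_def)
  have star: "tape_star C P Q \<in> hom (tape_category C) P Q"
    using ob by (simp add: hom_def)
  have eq: "scal (tape_category C) (tape_star C) (tape_plus C) p X =
      ext_plus (tape_plus C) p X (tape_star C P Q)"
    using assms(1) by (auto simp: scal_def hom_def)
  show "scal (tape_category C) (tape_star C) (tape_plus C) p X \<in> hom (tape_category C) P Q"
    unfolding eq using assms star by (intro tape_sem_ext_plus)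
  show "tape_sem C (scal (tape_category C) (tape_star C) (tape_plus C) p X) xs =
      scale p (tape_sem C X xs)" if "valuation C Q xs"
    unfolding eq using assms star that ob tape_sem_ext_plus(2)[OF assms(1) star assms(2,3) that]
    by (auto simp: tape_sem_star scale_def hom_def intro: nth_equalityI)
qed

text \<open>Arrows out of the empty word have empty values, so faithfulness gives initiality;
  terminality is naturality of discarding.\<close>

lemma tape_zero_object: "is_zero_object (tape_category C) []"
  unfolding is_zero_object_def
proof (intro conjI ballI)
  fix A assume A: "A \<in> Ob (tape_category C)"
  show "\<exists>!f. f \<in> hom (tape_category C) [] A"
  proof (rule ex1I[of _ "cb A"])
    fix f assume f: "f \<in> hom (tape_category C) [] A"
    show "f = cb A"
      by (rule tape_eqI[of _ "[]" A]) (use f A in \<open>auto simp: hom_def simp flip: length_0_conv\<close>)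
  qed (use A in \<open>simp add: hom_def\<close>)
  show "\<exists>!f. f \<in> hom (tape_category C) A []"
  proof (rule ex1I[of _ "br A"])
    fix f assume f: "f \<in> hom (tape_category C) A []"
    then show "f = br A"
      using tape_bang_nat[of f A "[]"] tape_id_right[of f "[]"] by (simp add: hom_def)
  qed (use A in \<open>simp add: hom_def\<close>)
qed simp

section \<open>Binary convex biproducts\<close>

lemma valuation_append:
  "valuation C (P @ Q) zs \<Longrightarrow> \<exists>xs ys. zs = xs @ ys \<and> valuation C P xs \<and> valuation C Q ys"
  by (auto simp: list_all2_append1)

lemma tape_sem_biproduct:
  assumes "P \<in> lists (Ob C)" "Q \<in> lists (Ob C)"
  shows "valuation C P xs \<Longrightarrow> valuation C Q ys \<Longrightarrow> tape_sem C (cls C (idw P \<oplus> cobangw Q)) (xs @ ys) = xs"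
    and "valuation C P xs \<Longrightarrow> valuation C Q ys \<Longrightarrow> tape_sem C (cls C (cobangw P \<oplus> idw Q)) (xs @ ys) = ys"
    and "valuation C P xs \<Longrightarrow> tape_sem C (cls C (idw P \<oplus> bangw Q)) xs = xs @ replicate (length Q) (\<lambda>_. 0)"
    and "valuation C Q ys \<Longrightarrow> tape_sem C (cls C (bangw P \<oplus> idw Q)) ys = replicate (length P) (\<lambda>_. 0) @ ys"
proof -
  have "sem C (idw P \<oplus> bangw Q) (xs @ []) = xs @ replicate (length Q) (\<lambda>_. 0)"
    if "length xs = length P"
    using that by (simp only: sem_par_append typed_words sem_idw sem_bangw)
  moreover have "sem C (bangw P \<oplus> idw Q) ([] @ ys) = replicate (length P) (\<lambda>_. 0) @ ys"
    if "length ys = length Q"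
    using that by (simp only: sem_par_append typed_words sem_idw sem_bangw list.size)
  ultimately show
    "valuation C P xs \<Longrightarrow> valuation C Q ys \<Longrightarrow> tape_sem C (cls C (idw P \<oplus> cobangw Q)) (xs @ ys) = xs"
    "valuation C P xs \<Longrightarrow> valuation C Q ys \<Longrightarrow> tape_sem C (cls C (cobangw P \<oplus> idw Q)) (xs @ ys) = ys"
    "valuation C P xs \<Longrightarrow> tape_sem C (cls C (idw P \<oplus> bangw Q)) xs = xs @ replicate (length Q) (\<lambda>_. 0)"
    "valuation C Q ys \<Longrightarrow> tape_sem C (cls C (bangw P \<oplus> idw Q)) ys = replicate (length P) (\<lambda>_. 0) @ ys"
    using assms list_all2_lengthD[of "local_on C" P xs] list_all2_lengthD[of "local_on C" Q ys]
    by (simp_all add: list_all2_appendI)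
qed

text \<open>The zero-padded lists are the values of the two projections in
  \<open>tape_sem_biproduct\<close>, so an arrow into \<open>P @ Q\<close> is determined by its
  composites with the projections. Here the factor one half has disappeared: functionals may be
  added with coefficients 1 and 1.\<close>

lemma tape_sem_append:
  assumes "arr X" "tc X = P @ Q" "valuation C P xs" "valuation C Q ys"
  shows "tape_sem C X (xs @ ys) =
    lincomb 1 1 (tape_sem C X (xs @ replicate (length Q) (\<lambda>_. 0)))
      (tape_sem C X (replicate (length P) (\<lambda>_. 0) @ ys))"
proof -
  have l: "length xs = length P" "length ys = length Q" using assms by (auto dest: list_all2_lengthD)
  let ?x = "xs @ replicate (length Q) (\<lambda>_. 0)" and ?y = "replicate (length P) (\<lambda>_. 0) @ ys"
  have "xs @ ys = lincomb 1 1 ?x ?y"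
    using l by (intro nth_equalityI) (auto simp: nth_append)
  moreover have "valuation C (P @ Q) ?x" "valuation C (P @ Q) ?y"
    using assms by (auto intro: list_all2_appendI)
  ultimately show ?thesis using assms(1,2) by (metis tape_sem_lincomb valuation_lincomb)
qed

text \<open>On valuations, copairing concatenates the values of the two arrows and convex pairing is
  \<open>lincomb q1 q2\<close>.\<close>

lemma tape_convex_biproduct:
  assumes P: "P1 \<in> lists (Ob C)" "P2 \<in> lists (Ob C)"
  shows "is_convex_biproduct (tape_category C) (tape_star C) (tape_plus C) P1 P2 (P1 @ P2)
         (cls C (idw P1 \<oplus> cobangw P2)) (cls C (cobangw P1 \<oplus> idw P2))
         (cls C (idw P1 \<oplus> bangw P2)) (cls C (bangw P1 \<oplus> idw P2))"
    (is "is_convex_biproduct ?T ?s ?c _ _ _ ?i1 ?i2 ?p1 ?p2")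
  unfolding is_convex_biproduct_def
proof (intro conjI)
  note [simp del] = cmp_cls par_cls
  note sem = tape_sem_biproduct[OF P]
  have i: "?i1 \<in> hom ?T P1 (P1 @ P2)" "?i2 \<in> hom ?T P2 (P1 @ P2)"
    and p: "?p1 \<in> hom ?T (P1 @ P2) P1" "?p2 \<in> hom ?T (P1 @ P2) P2"
    using P by (simp_all add: hom_def)
  show "is_coproduct ?T P1 P2 (P1 @ P2) ?i1 ?i2"
    unfolding is_coproduct_def
  proof (intro conjI ballI)
    fix A f1 f2
    assume A: "A \<in> Ob ?T" and f: "f1 \<in> hom ?T P1 A" "f2 \<in> hom ?T P2 A"
    let ?h = "(f1 \<otimes> f2) \<cdot> mg A"
    have h: "?h \<in> hom ?T (P1 @ P2) A" using A f by (simp add: hom_def)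
    have sem_h: "tape_sem C ?h xs = tape_sem C f1 xs @ tape_sem C f2 xs" if "valuation C A xs" for xs
    proof -
      have "valuation C (A @ A) (xs @ xs)" using that by (simp add: list_all2_appendI)
      then show ?thesis using A f that by (simp add: hom_def tape_sem_par list_all2_lengthD)
    qed
    have val: "valuation C P1 (tape_sem C f1 xs)" "valuation C P2 (tape_sem C f2 xs)"
      if "valuation C A xs" for xs
      using that f valuation_tape_sem[of f1 A xs] valuation_tape_sem[of f2 A xs]
      by (auto simp: hom_def)
    show "\<exists>!h. h \<in> hom ?T (P1 @ P2) A \<and> ?i1 \<cdot> h = f1 \<and> ?i2 \<cdot> h = f2"
    proof (rule ex1I[of _ ?h], intro conjI)
      show "?i1 \<cdot> ?h = f1"
        by (rule tape_eqI[of _ P1 A]) (use i h f val sem_h sem(1) in \<open>simp_all add: hom_def del: tape_sem_cls\<close>)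
      show "?i2 \<cdot> ?h = f2"
        by (rule tape_eqI[of _ P2 A]) (use i h f val sem_h sem(2) in \<open>simp_all add: hom_def del: tape_sem_cls\<close>)
    next
      fix g assume "g \<in> hom ?T (P1 @ P2) A \<and> ?i1 \<cdot> g = f1 \<and> ?i2 \<cdot> g = f2"
      then have g: "g \<in> hom ?T (P1 @ P2) A" and ig: "?i1 \<cdot> g = f1" "?i2 \<cdot> g = f2" by blast+
      show "g = ?h"
      proof (rule tape_eqI[of _ "P1 @ P2" A])
        fix xs assume xs: "valuation C A xs"
        have "valuation C (P1 @ P2) (tape_sem C g xs)"
          using g xs valuation_tape_sem[of g A xs] by (simp add: hom_def)
        then obtain ys zs where yz: "tape_sem C g xs = ys @ zs" "valuation C P1 ys" "valuation C P2 zs"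
          using valuation_append by blast
        have "tape_sem C (?i1 \<cdot> g) xs = ys" "tape_sem C (?i2 \<cdot> g) xs = zs"
          using g i xs yz sem(1,2) by (simp_all add: hom_def del: tape_sem_cls)
        then show "tape_sem C g xs = tape_sem C ?h xs" using ig yz sem_h[OF xs] by simp
      qed (use g h in \<open>auto simp: hom_def\<close>)
    qed (rule h)
  qed (use P i in simp_all)
  show "is_convex_product ?T ?s ?c P1 P2 (P1 @ P2) ?p1 ?p2"
    unfolding is_convex_product_def
  proof (intro conjI ballI impI)
    fix A q1 q2 f1 f2
    assume A: "A \<in> Ob ?T" and q: "q1 \<in> {0..1}" "q2 \<in> {0..1}" "q1 + q2 \<le> (1::real)"
      and f: "f1 \<in> hom ?T A P1" "f2 \<in> hom ?T A P2"
    \<comment> \<open>If \<open>q1 = 1\<close>, then \<open>q2 = 0\<close> and the quotient is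
      \<open>0 / 0 = 0\<close>, so all three facts persist.\<close>
    have r: "0 \<le> q2 / (1 - q1)" "q2 / (1 - q1) \<le> 1" "(1 - q1) * (q2 / (1 - q1)) = q2"
      using q by (auto simp: divide_le_eq)
    \<comment> \<open>Both arrows are injected into the sum and mixed with weight \<open>q1\<close>;
      scaling the second by \<open>q2 / (1 - q1)\<close> gives it total weight
      \<open>q2\<close>.\<close>
    let ?g1 = "f1 \<cdot> ?i1" and ?g2 = "scal ?T ?s ?c (q2 / (1 - q1)) (f2 \<cdot> ?i2)"
    let ?h = "ext_plus ?c q1 ?g1 ?g2"
    have f2i: "f2 \<cdot> ?i2 \<in> hom ?T A (P1 @ P2)" using f i by (simp add: hom_def)
    have g: "?g1 \<in> hom ?T A (P1 @ P2)" "?g2 \<in> hom ?T A (P1 @ P2)"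
      using f i tape_sem_scal(1)[OF f2i r(1,2)] by (simp_all add: hom_def)
    have h: "?h \<in> hom ?T A (P1 @ P2)"
      using g q by (intro tape_sem_ext_plus) auto
    have sem_h: "tape_sem C ?h (xs @ ys) = lincomb q1 q2 (tape_sem C f1 xs) (tape_sem C f2 ys)"
      if v: "valuation C P1 xs" "valuation C P2 ys" for xs ys
    proof -
      have xy: "valuation C (P1 @ P2) (xs @ ys)" using v by (simp add: list_all2_appendI)
      have "tape_sem C ?g1 (xs @ ys) = tape_sem C f1 xs" "tape_sem C (f2 \<cdot> ?i2) (xs @ ys) = tape_sem C f2 ys"
        using f i xy v sem(1,2) by (simp_all add: hom_def del: tape_sem_cls)
      then have "tape_sem C ?h (xs @ ys) =
          lincomb q1 (1 - q1) (tape_sem C f1 xs) (scale (q2 / (1 - q1)) (tape_sem C f2 ys))"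
        using tape_sem_ext_plus(2)[OF g _ _ xy] tape_sem_scal(2)[OF f2i r(1,2) xy] q by simp
      also have "\<dots> = lincomb q1 q2 (tape_sem C f1 xs) (tape_sem C f2 ys)"
        by (rule nth_equalityI) (auto simp: scale_def mult.assoc[symmetric] r(3) simp del: times_divide_eq_right times_divide_eq_left)
      finally show ?thesis .
    qed
    show "\<exists>!h. h \<in> hom ?T A (P1 @ P2) \<and> h \<cdot> ?p1 = scal ?T ?s ?c q1 f1 \<and> h \<cdot> ?p2 = scal ?T ?s ?c q2 f2"
    proof (rule ex1I[of _ ?h], intro conjI)
      have f0: "tape_sem C f1 (replicate (length P1) (\<lambda>_. 0)) = replicate (length A) (\<lambda>_. 0)"
        "tape_sem C f2 (replicate (length P2) (\<lambda>_. 0)) = replicate (length A) (\<lambda>_. 0)"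
        using f tape_sem_zero by (simp_all add: hom_def)
      show "?h \<cdot> ?p1 = scal ?T ?s ?c q1 f1"
      proof (rule tape_eqI[of _ A P1])
        fix xs assume xs: "valuation C P1 xs"
        have "tape_sem C (?h \<cdot> ?p1) xs = lincomb q1 q2 (tape_sem C f1 xs) (replicate (length A) (\<lambda>_. 0))"
          using xs h p sem(3)[OF xs] sem_h[OF xs, of "replicate (length P2) (\<lambda>_. 0)"] f0
          by (simp add: hom_def del: tape_sem_cls)
        also have "\<dots> = scale q1 (tape_sem C f1 xs)"
          using f by (auto intro!: nth_equalityI simp: scale_def hom_def)
        finally show "tape_sem C (?h \<cdot> ?p1) xs = tape_sem C (scal ?T ?s ?c q1 f1) xs"
          using tape_sem_scal(2)[OF f(1) _ _ xs] q by simp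
      qed (use h p q tape_sem_scal(1)[OF f(1)] in \<open>simp_all add: hom_def\<close>)
      show "?h \<cdot> ?p2 = scal ?T ?s ?c q2 f2"
      proof (rule tape_eqI[of _ A P2])
        fix xs assume xs: "valuation C P2 xs"
        have "tape_sem C (?h \<cdot> ?p2) xs = lincomb q1 q2 (replicate (length A) (\<lambda>_. 0)) (tape_sem C f2 xs)"
          using xs h p sem(4)[OF xs] sem_h[OF _ xs, of "replicate (length P1) (\<lambda>_. 0)"] f0
          by (simp add: hom_def del: tape_sem_cls)
        also have "\<dots> = scale q2 (tape_sem C f2 xs)"
          using f by (auto intro!: nth_equalityI simp: scale_def hom_def)
        finally show "tape_sem C (?h \<cdot> ?p2) xs = tape_sem C (scal ?T ?s ?c q2 f2) xs"
          using tape_sem_scal(2)[OF f(2) _ _ xs] q by simp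
      qed (use h p q tape_sem_scal(1)[OF f(2)] in \<open>simp_all add: hom_def\<close>)
    next
      fix g assume "g \<in> hom ?T A (P1 @ P2) \<and> g \<cdot> ?p1 = scal ?T ?s ?c q1 f1 \<and> g \<cdot> ?p2 = scal ?T ?s ?c q2 f2"
      then have g': "g \<in> hom ?T A (P1 @ P2)"
        and gp: "g \<cdot> ?p1 = scal ?T ?s ?c q1 f1" "g \<cdot> ?p2 = scal ?T ?s ?c q2 f2" by blast+
      show "g = ?h"
      proof (rule tape_eqI[of _ A "P1 @ P2"])
        fix zs assume "valuation C (P1 @ P2) zs"
        then obtain xs ys where z: "zs = xs @ ys" "valuation C P1 xs" "valuation C P2 ys"
          using valuation_append by blast
        have "tape_sem C g (xs @ replicate (length P2) (\<lambda>_. 0)) = tape_sem C (g \<cdot> ?p1) xs"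
          "tape_sem C g (replicate (length P1) (\<lambda>_. 0) @ ys) = tape_sem C (g \<cdot> ?p2) ys"
          using g' p z sem(3)[OF z(2)] sem(4)[OF z(3)] by (simp_all add: hom_def del: tape_sem_cls)
        then have "tape_sem C g (xs @ ys) = lincomb 1 1 (scale q1 (tape_sem C f1 xs)) (scale q2 (tape_sem C f2 ys))"
          using tape_sem_append[of g P1 P2 xs ys] g' gp z q tape_sem_scal(2)[OF f(1) _ _ z(2)]
            tape_sem_scal(2)[OF f(2) _ _ z(3)] by (simp add: hom_def)
        also have "\<dots> = lincomb q1 q2 (tape_sem C f1 xs) (tape_sem C f2 ys)"
          by (rule nth_equalityI) (auto simp: scale_def)
        finally show "tape_sem C g zs = tape_sem C ?h zs" using z sem_h by simp
      qed (use g' h in \<open>auto simp: hom_def\<close>)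
    qed (rule h)
  qed (use P p in simp_all)
  have eq: "X = Y" if "X \<in> hom ?T P Q" "Y \<in> hom ?T P Q"
    "\<And>xs. valuation C Q xs \<Longrightarrow> tape_sem C X xs = tape_sem C Y xs" for X Y P Q
    using that tape_eqI[of X P Q Y] by (simp add: hom_def)
  have z: "valuation C P1 (replicate (length P1) (\<lambda>_. 0))" "valuation C P2 (replicate (length P2) (\<lambda>_. 0))"
    by simp_all
  show "?i1 \<cdot> ?p1 = Ident ?T P1"
  proof (rule eq)
    fix xs assume v: "valuation C P1 xs"
    show "tape_sem C (?i1 \<cdot> ?p1) xs = tape_sem C (Ident ?T P1) xs"
      using P i p v sem(1)[OF v z(2)] sem(3)[OF v] list_all2_lengthD[OF v]
      by (simp add: hom_def tape_sem_cls[of "idw _"] del: tape_sem_cls)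
  qed (use P i p in \<open>simp_all add: hom_def\<close>)
  show "?i2 \<cdot> ?p2 = Ident ?T P2"
  proof (rule eq)
    fix xs assume v: "valuation C P2 xs"
    show "tape_sem C (?i2 \<cdot> ?p2) xs = tape_sem C (Ident ?T P2) xs"
      using P i p v sem(2)[OF z(1) v] sem(4)[OF v] list_all2_lengthD[OF v]
      by (simp add: hom_def tape_sem_cls[of "idw _"] del: tape_sem_cls)
  qed (use P i p in \<open>simp_all add: hom_def\<close>)
  show "?i1 \<cdot> ?p2 = ?s P1 P2"
  proof (rule eq)
    fix xs assume v: "valuation C P2 xs"
    show "tape_sem C (?i1 \<cdot> ?p2) xs = tape_sem C (?s P1 P2) xs"
      using P i p v sem(1)[OF z(1) v] sem(4)[OF v] list_all2_lengthD[OF v]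
      by (simp add: hom_def tape_sem_star del: tape_sem_cls)
  qed (use P i p in \<open>simp_all add: hom_def\<close>)
  show "?i2 \<cdot> ?p1 = ?s P2 P1"
  proof (rule eq)
    fix xs assume v: "valuation C P1 xs"
    show "tape_sem C (?i2 \<cdot> ?p1) xs = tape_sem C (?s P2 P1) xs"
      using P i p v sem(2)[OF v z(2)] sem(3)[OF v] list_all2_lengthD[OF v]
      by (simp add: hom_def tape_sem_star del: tape_sem_cls)
  qed (use P i p in \<open>simp_all add: hom_def\<close>)
qed

end

section \<open>Convex pairings\<close>

text \<open>The conventions for the weights 0 and 1 agree with the formula for proper weights, so
  the interpretation needs no case distinction.\<close>

lemma ext_split_simps [simp]:
  "src C (ext_split p U) = [U]" "tgt C (ext_split p U) = [U, U]"
  "0 \<le> p \<Longrightarrow> p \<le> 1 \<Longrightarrow> typed C (ext_split p U) \<longleftrightarrow> U \<in> Ob C"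
  "sem C (ext_split p U) [x, y] = [\<lambda>\<phi>. p * x \<phi> + (1 - p) * y \<phi>]"
  by (auto simp: ext_split_def sem_par_Cons sem.simps(10))

text \<open>If \<open>p = 1\<close>, all later weights vanish, and so the value 0 for the rescaled
  ones still satisfies \<open>(1 - p) * q r = r\<close>. The admissible weight lists are thus closed
  under the recursion of \<open>multi_split\<close>.\<close>

lemma rescaled_weights:
  fixes p :: real
  assumes "set (p # ps) \<subseteq> {0..1}" "sum_list (p # ps) \<le> 1"
  defines "q \<equiv> (\<lambda>r. if p \<noteq> 1 then r / (1 - p) else 0)"
  shows "set (map q ps) \<subseteq> {0..1}" "sum_list (map q ps) \<le> 1" "r \<in> set ps \<Longrightarrow> (1 - p) * q r = r"
proof -
  have nonneg: "\<And>r. r \<in> set ps \<Longrightarrow> 0 \<le> r" using assms(1) by auto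
  have le: "r \<le> 1 - p" if "r \<in> set ps" for r
    using member_le_sum_list[of r ps] nonneg that assms(2) by force
  show "set (map q ps) \<subseteq> {0..1}"
    using nonneg le assms(1) by (auto simp: q_def divide_le_eq)
  show "(1 - p) * q r = r" if "r \<in> set ps"
    using nonneg[OF that] le[OF that] by (auto simp: q_def)
  have "sum_list (map q ps) = sum_list ps / (1 - p)" if "p \<noteq> 1"
    using that by (induction ps) (auto simp: q_def add_divide_distrib)
  moreover have "sum_list (map q ps) = 0" if "p = 1"
    using that by (induction ps) (auto simp: q_def)
  ultimately show "sum_list (map q ps) \<le> 1"
    using assms(1,2) by (cases "p = 1") (auto simp: divide_le_eq)
qed

lemma typed_multi_split:
  "set ps \<subseteq> {0..1} \<Longrightarrow> sum_list ps \<le> 1 \<Longrightarrow> U \<in> Ob C \<Longrightarrow>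
   typed C (multi_split ps U) \<and> src C (multi_split ps U) = [U] \<and>
   tgt C (multi_split ps U) = replicate (length ps) U"
proof (induction ps U rule: multi_split.induct)
  case (2 p ps U)
  then show ?case using rescaled_weights[of p ps] by simp
qed simp

text \<open>The factor \<open>1 - p\<close> in front of the tail undoes the rescaling, so the
  original weights reappear.\<close>

lemma sem_multi_split:
  "set ps \<subseteq> {0..1} \<Longrightarrow> sum_list ps \<le> 1 \<Longrightarrow> length xs = length ps \<Longrightarrow>
   sem C (multi_split ps U) xs = [\<lambda>\<phi>. (\<Sum>i<length ps. ps ! i * (xs ! i) \<phi>)]"
proof (induction ps U arbitrary: xs rule: multi_split.induct)
  case (2 p ps U)
  define qs where "qs = map (\<lambda>r. if p \<noteq> 1 then r / (1 - p) else 0) ps"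
  obtain x ys where xs: "xs = x # ys" "length ys = length ps"
    using 2 by (auto simp: length_Suc_conv)
  have q: "set qs \<subseteq> {0..1}" "sum_list qs \<le> 1" "\<And>i. i < length ps \<Longrightarrow> (1 - p) * qs ! i = ps ! i"
    using rescaled_weights[of p ps] 2(2,3) by (auto simp: qs_def)
  have "sem C (multi_split qs U) ys = [\<lambda>\<phi>. (\<Sum>i<length ps. qs ! i * (ys ! i) \<phi>)]"
    using 2(1)[of ys] q xs by (simp add: qs_def)
  then have "sem C (multi_split (p # ps) U) xs =
      [\<lambda>\<phi>. p * x \<phi> + (1 - p) * (\<Sum>i<length ps. qs ! i * (ys ! i) \<phi>)]"
    by (simp add: xs sem_par_Cons flip: qs_def)
  also have "\<dots> = [\<lambda>\<phi>. p * x \<phi> + (\<Sum>i<length ps. ps ! i * (ys ! i) \<phi>)]"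
    using q by (simp add: sum_distrib_left mult.assoc[symmetric])
  finally show ?case 
    by (simp add: xs sum.lessThan_Suc_shift del: sum.lessThan_Suc sem.simps multi_split.simps)
qed simp

section \<open>Pairings of several arrows\<close>

context category
begin

text \<open>Each factor goes from one letter to one letter, so its value is a single functional and
  the composite acts entry by entry.\<close>

lemma tape_big_par:
  "list_all2 (\<lambda>t V. t \<in> hom (tape_category C) [U] [V]) ts Us \<Longrightarrow>
   tape_big_par C ts \<in> hom (tape_category C) (replicate (length ts) U) Us \<and>
   (\<forall>xs. valuation C Us xs \<longrightarrow>
      tape_sem C (tape_big_par C ts) xs = map2 (\<lambda>t x. tape_sem C t [x] ! 0) ts xs)"
proof (induction ts Us rule: list_all2_induct)
  case Nil
  then show ?case by (simp add: tape_big_par_def hom_def)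
next
  case (Cons t ts V Us)
  have eq: "tape_big_par C (t # ts) = t \<otimes> tape_big_par C ts" by (simp add: tape_big_par_def)
  have t: "arr t" "td t = [U]" "tc t = [V]" using Cons by (simp_all add: hom_def)
  have "tape_sem C (t \<otimes> tape_big_par C ts) (x # xs) =
      (tape_sem C t [x] ! 0) # map2 (\<lambda>t x. tape_sem C t [x] ! 0) ts xs"
    if "local_on C V x" "valuation C Us xs" for x xs
  proof -
    have "tape_sem C (t \<otimes> tape_big_par C ts) ([x] @ xs) =
        tape_sem C t [x] @ tape_sem C (tape_big_par C ts) xs"
      using t Cons that by (intro tape_sem_par) (auto simp: hom_def)
    moreover have "tape_sem C t [x] = [tape_sem C t [x] ! 0]"
      using t by (intro nth_equalityI) auto
    ultimately show ?thesis using Cons that by simp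
  qed
  then show ?case using Cons t unfolding eq by (auto simp: hom_def list_all2_Cons1)
qed

lemma tape_projs_simps:
  assumes "Us \<in> lists (Ob C)" "i < length Us"
  shows "tape_projs C Us ! i \<in> hom (tape_category C) Us [Us ! i]"
    and "local_on C (Us ! i) x \<Longrightarrow> tape_sem C (tape_projs C Us ! i) [x] =
      (replicate (length Us) (\<lambda>_. 0))[i := x]"
proof -
  let ?t = "bangw (take i Us) \<oplus> IdO (Us ! i) \<oplus> bangw (drop (Suc i) Us)"
  have ob: "take i Us \<in> lists (Ob C)" "drop (Suc i) Us \<in> lists (Ob C)" "Us ! i \<in> Ob C"
    using assms by (auto simp: in_lists_conv_set dest: in_set_takeD in_set_dropD)
  have t: "typed C ?t" "src C ?t = Us" "tgt C ?t = [Us ! i]"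
    using ob assms(2) by (simp_all add: id_take_nth_drop[symmetric])
  have eq: "tape_projs C Us ! i = cls C ?t" using assms by (simp add: tape_projs_def)
  show "tape_projs C Us ! i \<in> hom (tape_category C) Us [Us ! i]"
    using t by (simp add: eq hom_def)
  assume x: "local_on C (Us ! i) x"
  \<comment> \<open>The empty lists are the inputs of the two \<open>bangw\<close> blocks, written
    out so that \<open>sem_par_append\<close> applies.\<close>
  have "sem C ?t ([] @ [x] @ []) = replicate i (\<lambda>_. 0) @ [x] @ replicate (length Us - Suc i) (\<lambda>_. 0)"
    using assms by (subst sem_par_append, simp, subst sem_par_append) simp_all
  also have "\<dots> = (replicate (length Us) (\<lambda>_. 0))[i := x]"
    using assms by (intro nth_equalityI) (auto simp: nth_append nth_list_update nth_Cons')
  finally show "tape_sem C (tape_projs C Us ! i) [x] = (replicate (length Us) (\<lambda>_. 0))[i := x]"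
    using t x by (simp add: eq)
qed

lemma valuation_update:
  "valuation C P xs \<Longrightarrow> local_on C (P ! i) x \<Longrightarrow> valuation C P (xs[i := x])"
  by (cases "i < length xs") (auto simp: list_all2_conv_all_nth nth_list_update)

text \<open>The analogue of \<open>tape_sem_append\<close> for many summands: a valuation is the sum
  of its entries, each padded with zeros, and the projections produce exactly these padded
  lists.\<close>

lemma eq_if_projs_eq:
  assumes X: "X \<in> hom (tape_category C) P Us" and Y: "Y \<in> hom (tape_category C) P Us"
    and eq: "\<And>i. i < length Us \<Longrightarrow> X \<cdot> (tape_projs C Us ! i) = Y \<cdot> (tape_projs C Us ! i)"
  shows "X = Y"
proof (rule tape_eqI[of X P Us Y])
  fix xs assume xs: "valuation C Us xs"
  then have l: "length xs = length Us" and loc: "\<And>i. i < length Us \<Longrightarrow> local_on C (Us ! i) (xs ! i)"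
    by (auto simp: list_all2_conv_all_nth)
  have Us: "Us \<in> lists (Ob C)" using X tc_ob[of X] by (simp add: hom_def)
  \<comment> \<open>Interpolates between the zero list and \<open>xs\<close>, so that linearity can
    be applied one place at a time.\<close>
  define z where "z k = take k xs @ replicate (length Us - k) (\<lambda>_. 0)" for k
  have val: "valuation C Us (z k)" if "k \<le> length Us" for k
    using that loc l by (auto simp: z_def list_all2_conv_all_nth nth_append)
  have "tape_sem C X (z k) = tape_sem C Y (z k)" if "k \<le> length Us" for k
    using that
  proof (induction k)
    case 0
    then show ?case using X Y tape_sem_zero by (simp add: z_def hom_def)
  next
    case (Suc k)
    let ?e = "(replicate (length Us) (\<lambda>_. 0))[k := xs ! k]"
    have e: "valuation C Us ?e" using loc Suc.prems by (intro valuation_update) auto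
    have z: "z (Suc k) = lincomb 1 1 (z k) ?e"
      using Suc.prems l
      by (intro nth_equalityI) (auto simp: z_def nth_append nth_list_update less_Suc_eq)
    have "tape_sem C Z ?e = tape_sem C (Z \<cdot> (tape_projs C Us ! k)) [xs ! k]"
      if "Z \<in> hom (tape_category C) P Us" for Z
      using that Suc.prems loc tape_projs_simps[OF Us, of k] by (simp add: hom_def)
    then have "tape_sem C X ?e = tape_sem C Y ?e" using X Y eq[of k] Suc.prems by simp
    then show ?case
      unfolding z using Suc X Y e val by (simp add: tape_sem_lincomb hom_def)
  qed
  from this[of "length Us"] show "tape_sem C X xs = tape_sem C Y xs" using l by (simp add: z_def)
qed (use X Y in \<open>simp_all add: hom_def\<close>)

text \<open>The value is the weighted sum of the values of all \<open>ts\<close>. The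
  \<open>i\<close>-th projection feeds in a list that is zero outside place \<open>i\<close>, and an
  arrow sends zero to zero, so one summand survives.\<close>

lemma tape_convex_pairing:
  assumes U: "U \<in> Ob C" and Us: "Us \<in> lists (Ob C)"
    and l: "length ps = length Us" "length ts = length Us"
    and ps: "set ps \<subseteq> {0..1}" "sum_list ps \<le> 1"
    and ts: "\<And>i. i < length Us \<Longrightarrow> ts ! i \<in> hom (tape_category C) [U] [Us ! i]"
  shows "is_convex_pairing (tape_category C) (tape_star C) (tape_plus C)
    [U] Us (tape_projs C Us) ps ts (cls C (multi_split ps U) \<cdot> tape_big_par C ts)"
  unfolding is_convex_pairing_def
proof (intro conjI allI impI)
  note [simp del] = cmp_cls
  let ?m = "cls C (multi_split ps U)" and ?b = "tape_big_par C ts"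
  let ?h = "?m \<cdot> ?b"
  note m = typed_multi_split[OF ps U]
  have "list_all2 (\<lambda>t V. t \<in> hom (tape_category C) [U] [V]) ts Us"
    using l ts by (simp add: list_all2_conv_all_nth)
  note b = tape_big_par[OF this]
  show h: "?h \<in> hom (tape_category C) [U] Us" using m b l by (simp add: hom_def)
  have sem_h: "tape_sem C ?h xs =
      [\<lambda>\<phi>. (\<Sum>i<length Us. ps ! i * (tape_sem C (ts ! i) [xs ! i] ! 0) \<phi>)]"
    if xs: "valuation C Us xs" for xs
  proof -
    have "valuation C (replicate (length Us) U) (tape_sem C ?b xs)"
      using b xs l valuation_tape_sem[of ?b Us xs] by (simp add: hom_def)
    then have "tape_sem C ?h xs = sem C (multi_split ps U) (tape_sem C ?b xs)"
      using m b xs l by (simp add: hom_def)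
    also have "\<dots> = [\<lambda>\<phi>. (\<Sum>i<length ps. ps ! i * (tape_sem C ?b xs ! i) \<phi>)]"
      using b l by (intro sem_multi_split[OF ps]) (simp add: hom_def)
    finally show ?thesis
      using b xs l by (simp add: list_all2_lengthD)
  qed
  fix i assume "i < length (tape_projs C Us)"
  then have i: "i < length Us" by (simp add: tape_projs_def)
  note proj = tape_projs_simps[OF Us i]
  have p: "0 \<le> ps ! i" "ps ! i \<le> 1" using ps i l by (auto simp: subset_iff)
  note scal = tape_sem_scal[OF ts[OF i] p]
  show "?h \<cdot> (tape_projs C Us ! i) =
      scal (tape_category C) (tape_star C) (tape_plus C) (ps ! i) (ts ! i)"
  proof (rule tape_eqI[of _ "[U]" "[Us ! i]"])
    fix xs assume xs: "valuation C [Us ! i] xs"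
    then obtain x where x: "xs = [x]" "local_on C (Us ! i) x" by (auto simp: list_all2_Cons1)
    let ?e = "(replicate (length Us) (\<lambda>_. 0))[i := x]"
    have "valuation C Us ?e" using x by (intro valuation_update) auto
    then have "tape_sem C (?h \<cdot> (tape_projs C Us ! i)) xs =
        [\<lambda>\<phi>. (\<Sum>j<length Us. ps ! j * (tape_sem C (ts ! j) [?e ! j] ! 0) \<phi>)]"
      using h proj x sem_h by (simp add: hom_def)
    also have "\<dots> = [\<lambda>\<phi>. (\<Sum>j<length Us. if j = i then ps ! i * (tape_sem C (ts ! i) [x] ! 0) \<phi> else 0)]"
    proof -
      have "ps ! j * (tape_sem C (ts ! j) [?e ! j] ! 0) \<phi> =
          (if j = i then ps ! i * (tape_sem C (ts ! i) [x] ! 0) \<phi> else 0)" if "j < length Us" for j \<phi>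
        using that ts[OF that] tape_sem_zero[of "ts ! j" "[Us ! j]"] by (auto simp: hom_def)
      then show ?thesis by simp
    qed
    also have "\<dots> = scale (ps ! i) (tape_sem C (ts ! i) xs)"
      using i x ts[OF i] by (intro nth_equalityI) (auto simp: scale_def hom_def)
    also have "\<dots> = tape_sem C (scal (tape_category C) (tape_star C) (tape_plus C) (ps ! i) (ts ! i)) xs"
      using scal(2)[OF xs] by simp
    finally show "tape_sem C (?h \<cdot> (tape_projs C Us ! i)) xs =
        tape_sem C (scal (tape_category C) (tape_star C) (tape_plus C) (ps ! i) (ts ! i)) xs" .
  qed (use h proj scal(1) in \<open>simp_all add: hom_def\<close>)
qed

end

theorem theorem3:
  fixes C :: "('o, 'a) category"
  assumes "category C"
  shows "convex_biproduct_category (tape_category C) (tape_star C) (tape_plus C) \<and>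
    is_zero_object (tape_category C) [] \<and>
    (\<forall>P1\<in>lists (Ob C). \<forall>P2\<in>lists (Ob C).
       is_convex_biproduct (tape_category C) (tape_star C) (tape_plus C) P1 P2 (P1 @ P2)
         (cls C (idw P1 \<oplus> cobangw P2)) (cls C (cobangw P1 \<oplus> idw P2))
         (cls C (idw P1 \<oplus> bangw P2)) (cls C (bangw P1 \<oplus> idw P2))) \<and>
    (\<forall>U\<in>Ob C. \<forall>Us\<in>lists (Ob C). \<forall>ps ts.
       length ps = length Us \<and> length ts = length Us \<and>
       set ps \<subseteq> {0..1} \<and> sum_list ps \<le> 1 \<and>
       (\<forall>i<length Us. ts ! i \<in> hom (tape_category C) [U] [Us ! i]) \<longrightarrow>
       (\<exists>!h. is_convex_pairing (tape_category C) (tape_star C) (tape_plus C)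
               [U] Us (tape_projs C Us) ps ts h) \<and>
       convex_pairing (tape_category C) (tape_star C) (tape_plus C)
           [U] Us (tape_projs C Us) ps ts =
         cls C (multi_split ps U) \<odot>\<^bsub>tape_category C\<^esub> tape_big_par C ts)"
proof -
  interpret category C by fact
  show ?thesis
  proof (intro conjI ballI allI impI)
    show "convex_biproduct_category (tape_category C) (tape_star C) (tape_plus C)"
    proof (intro convex_biproduct_category.intro convex_biproduct_category_axioms.intro)
      show "pca_enriched_category (tape_category C) (tape_star C) (tape_plus C)"
        by (rule tape_pca_enriched)
      show "\<exists>Z. is_zero_object (tape_category C) Z" using tape_zero_object by blast
      show "\<exists>B i1 i2 \<pi>1 \<pi>2.
          is_convex_biproduct (tape_category C) (tape_star C) (tape_plus C) X1 X2 B i1 i2 \<pi>1 \<pi>2"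
        if "X1 \<in> Ob (tape_category C)" "X2 \<in> Ob (tape_category C)" for X1 X2
        using tape_convex_biproduct[of X1 X2] that by fastforce
    qed
    show "is_zero_object (tape_category C) []" by (rule tape_zero_object)
  next
    fix P1 P2 assume "P1 \<in> lists (Ob C)" "P2 \<in> lists (Ob C)"
    then show "is_convex_biproduct (tape_category C) (tape_star C) (tape_plus C) P1 P2 (P1 @ P2)
         (cls C (idw P1 \<oplus> cobangw P2)) (cls C (cobangw P1 \<oplus> idw P2))
         (cls C (idw P1 \<oplus> bangw P2)) (cls C (bangw P1 \<oplus> idw P2))"
      by (rule tape_convex_biproduct)
  next
    fix U Us ts and ps :: "real list"
    assume U: "U \<in> Ob C" "Us \<in> lists (Ob C)" and
      *: "length ps = length Us \<and> length ts = length Us \<and>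
       set ps \<subseteq> {0..1} \<and> sum_list ps \<le> 1 \<and>
       (\<forall>i<length Us. ts ! i \<in> hom (tape_category C) [U] [Us ! i])"
    let ?P = "is_convex_pairing (tape_category C) (tape_star C) (tape_plus C)
        [U] Us (tape_projs C Us) ps ts"
    let ?h = "cls C (multi_split ps U) \<odot>\<^bsub>tape_category C\<^esub> tape_big_par C ts"
    have h: "?P ?h" using U * by (intro tape_convex_pairing) auto
    have uniq: "g = ?h" if "?P g" for g
      by (rule eq_if_projs_eq[of _ "[U]" Us])
        (use that h in \<open>simp_all add: is_convex_pairing_def tape_projs_def\<close>)
    show "\<exists>!h. ?P h" using h uniq by (rule ex1I)
    show "convex_pairing (tape_category C) (tape_star C) (tape_plus C) [U] Us (tape_projs C Us) ps ts = ?h"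
      unfolding convex_pairing_def using h uniq by (rule the_equality)
  qed
qed

end
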